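(* Let $m\ge2$ be an integer and $d_3'=\gcd(3,m)$. Then $$[\mathbb{O}^-]\circledcirc[\mathbb{D}_m\oplus\mathbb{Z}_2^c]=\begin{cases}\{[\mathbb{1}],[\mathbb{Z}_2],[\mathbb{Z}_2^-],[\mathbb{Z}_{d_3'}],[\mathbb{D}_{d_3'}^z],[\mathbb{Z}_4^-],[\mathbb{D}_2^z],[\mathbb{D}_4^d]\}&\text{if } 4\mid m,\\ \{[\mathbb{1}],[\mathbb{Z}_2],[\mathbb{Z}_2^-],[\mathbb{Z}_{d_3'}],[\mathbb{D}_{d_3'}^z],[\mathbb{D}_2],[\mathbb{D}_2^z]\}&\text{if } m\text{ is even and }4\nmid m,\\ \{[\mathbb{1}],[\mathbb{Z}_2],[\mathbb{Z}_2^-],[\mathbb{Z}_{d_3'}],[\mathbb{D}_{d_3'}^z]\}&\text{if } m\text{ is odd}.\end{cases}$$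
   Context: $[K]$ is the conjugacy class of a subgroup $K$ in $\mathrm{O}(3)$, and the clips operation is $[H_1]\circledcirc[H_2]=\{[H_1\cap gH_2g^{-1}]:g\in\mathrm{O}(3)\}$. $(e_1,e_2,e_3)$ is the canonical basis of $\mathbb{R}^3$, $\mathbf{r}(n,\theta)$ is the rotation by angle $\theta$ about the axis directed by $n\neq0$. $\mathbb{1}=\{\mathrm{Id}\}$; $\mathbb{Z}_2^c=\{\pm\mathrm{Id}\}$; $H\oplus\mathbb{Z}_2^c=H\cup(-H)$ for $H\subset\mathrm{SO}(3)$; $\mathbb{Z}_k=\{\mathbf{r}(e_3,2j\pi/k):0\le j\le k-1\}$; $\mathbb{D}_k=\langle\mathbf{r}(e_3,2\pi/k),\mathbf{r}(e_1,\pi)\rangle$ for $k\ge2$; $\mathbb{Z}_{2k}^-=\mathbb{Z}_k\cup(-\mathbf{r}(e_3,\pi/k))\mathbb{Z}_k$ for $k\ge1$; $\mathbb{D}_k^z=\mathbb{Z}_k\cup(-\mathbf{r}(e_1,\pi))\mathbb{Z}_k$ for $k\ge2$; $\mathbb{D}_{2k}^d=\mathbb{D}_k\cup(-\mathbf{r}(e_3,\pi/k))\mathbb{D}_k$ (the superscript $d$ is part of the name). $\mathbb{T}$ is the rotation group of the regular tetrahedron (order 12), generated by $\mathbf{r}(e_3,\pi),\mathbf{r}(e_1,\pi),\mathbf{r}(e_1+e_2+e_3,2\pi/3)$, and $\mathbb{O}^-=\mathbb{T}\cup(-\mathbf{r}(e_3,\pi/2))\mathbb{T}$. Conventions: $[\mathbb{Z}_1]=[\mathbb{1}]$,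 $[\mathbb{D}_1^z]=[\mathbb{Z}_2^-]$. *)

theory Defs
  imports "HOL-Analysis.Analysis" "HOL-Algebra.Generated_Groups"
begin

definition O3 :: "(real^3^3) monoid"
  where "O3 = \<lparr>carrier = {A. orthogonal_matrix A}, mult = (**), one = mat 1\<rparr>"

definition conjugate :: "real^3^3 \<Rightarrow> (real^3^3) set \<Rightarrow> (real^3^3) set"
  where "conjugate g H = (g <#\<^bsub>O3\<^esub> H) #>\<^bsub>O3\<^esub> inv\<^bsub>O3\<^esub> g"

definition conj_class :: "(real^3^3) set \<Rightarrow> (real^3^3) set set"
  where "conj_class K = {conjugate g K |g. g \<in> carrier O3}"

text \<open>
  The clips operation is an operation on conjugacy classes, so the definition ranges over all
  representatives; \<open>clips_conj_class\<close> below gives the usual formula for one choice of them.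
\<close>

definition clips ::
    "(real^3^3) set set \<Rightarrow> (real^3^3) set set \<Rightarrow> (real^3^3) set set set"  (infixl "\<circledcirc>" 70)
  where "C1 \<circledcirc> C2 =
    {conj_class (H1 \<inter> conjugate g H2) |H1 H2 g. H1 \<in> C1 \<and> H2 \<in> C2 \<and> g \<in> carrier O3}"

abbreviation e1 :: "real^3" where "e1 \<equiv> axis 1 1"
abbreviation e2 :: "real^3" where "e2 \<equiv> axis 2 1"
abbreviation e3 :: "real^3" where "e3 \<equiv> axis 3 1"

text \<open>Rodrigues' formula: the right-handed rotation by \<open>\<theta>\<close> about the axis directed by \<open>n \<noteq> 0\<close>.\<close>

definition rotation :: "real^3 \<Rightarrow> real \<Rightarrow> real^3^3"
  where "rotation n \<theta> = (let u = n /\<^sub>R norm n in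
    matrix (\<lambda>v. cos \<theta> *\<^sub>R v + sin \<theta> *\<^sub>R cross3 u v + ((1 - cos \<theta>) * (u \<bullet> v)) *\<^sub>R u))"

definition trivial_group :: "(real^3^3) set"
  where "trivial_group = {mat 1}"

definition with_Z2c :: "(real^3^3) set \<Rightarrow> (real^3^3) set"
  where "with_Z2c H = H \<union> uminus ` H"

definition Z :: "nat \<Rightarrow> (real^3^3) set"
  where "Z k = {rotation e3 (2 * real j * pi / real k) |j. j < k}"

definition D :: "nat \<Rightarrow> (real^3^3) set"
  where "D k = generate O3 {rotation e3 (2 * pi / real k), rotation e1 pi}"

text \<open>
  \<open>Z2k_minus k\<close> is \<open>\<int>\<^sub>2\<^sub>k\<^sup>-\<close> and \<open>D2k_d k\<close> is \<open>\<D>\<^sub>2\<^sub>k\<^sup>d\<close>: the argument is half of the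
  subscript of the group, so \<open>\<int>\<^sub>4\<^sup>-\<close> is \<open>Z2k_minus 2\<close>.
\<close>

definition Z2k_minus :: "nat \<Rightarrow> (real^3^3) set"
  where "Z2k_minus k = Z k \<union> ((- rotation e3 (pi / real k)) <#\<^bsub>O3\<^esub> Z k)"

definition D2k_d :: "nat \<Rightarrow> (real^3^3) set"
  where "D2k_d k = D k \<union> ((- rotation e3 (pi / real k)) <#\<^bsub>O3\<^esub> D k)"

text \<open>
  For \<open>k = 1\<close>, where \<open>\<D>\<^sub>1\<^sup>z\<close> is fixed up to conjugacy only by the convention
  \<open>[\<D>\<^sub>1\<^sup>z] = [\<int>\<^sub>2\<^sup>-]\<close>, the same formula works: see \<open>conj_class_Dz_1\<close>.
\<close>

definition Dz :: "nat \<Rightarrow> (real^3^3) set"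
  where "Dz k = Z k \<union> ((- rotation e1 pi) <#\<^bsub>O3\<^esub> Z k)"

definition T :: "(real^3^3) set"
  where "T = generate O3 {rotation e3 pi, rotation e1 pi, rotation (e1 + e2 + e3) (2 * pi / 3)}"

definition O_minus :: "(real^3^3) set"
  where "O_minus = T \<union> ((- rotation e3 (pi / 2)) <#\<^bsub>O3\<^esub> T)"


lemma carrier_O3 [simp]: "A \<in> carrier O3 \<longleftrightarrow> orthogonal_matrix A"
  and mult_O3 [simp]: "A \<otimes>\<^bsub>O3\<^esub> B = A ** B"
  and one_O3 [simp]: "\<one>\<^bsub>O3\<^esub> = mat 1"
  by (simp_all add: O3_def)

lemma group_O3: "group O3"
proof (rule groupI)
  fix A assume "A \<in> carrier O3"
  then show "\<exists>B\<in>carrier O3. B \<otimes>\<^bsub>O3\<^esub> A = \<one>\<^bsub>O3\<^esub>"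
    by (intro bexI[of _ "transpose A"]) (auto simp: orthogonal_matrix_def)
qed (auto simp: orthogonal_matrix_mul orthogonal_matrix_id matrix_mul_assoc)

interpretation O3: group O3
  by (rule group_O3)

lemma inv_O3: "orthogonal_matrix A \<Longrightarrow> inv\<^bsub>O3\<^esub> A = transpose A"
  by (rule O3.inv_equality) (auto simp: orthogonal_matrix_def)

lemma conjugate_image: "conjugate g H = (\<lambda>h. g \<otimes>\<^bsub>O3\<^esub> h \<otimes>\<^bsub>O3\<^esub> inv\<^bsub>O3\<^esub> g) ` H"
  by (auto simp: conjugate_def l_coset_def r_coset_def)

lemma conjugate_carrier:
  assumes "g \<in> carrier O3" "H \<subseteq> carrier O3"
  shows "conjugate g H \<subseteq> carrier O3"
  using assms by (force simp: conjugate_image simp del: carrier_O3 mult_O3)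

lemma conjugate_conjugate:
  assumes "a \<in> carrier O3" "b \<in> carrier O3" "H \<subseteq> carrier O3"
  shows "conjugate a (conjugate b H) = conjugate (a \<otimes>\<^bsub>O3\<^esub> b) H"
  unfolding conjugate_image image_image
  using assms by (intro image_cong) 
    (auto simp: O3.inv_mult_group O3.m_assoc subset_iff simp del: carrier_O3 mult_O3)

lemma conjugate_one: "H \<subseteq> carrier O3 \<Longrightarrow> conjugate \<one>\<^bsub>O3\<^esub> H = H"
  by (auto simp: conjugate_image subset_iff image_iff simp del: carrier_O3 mult_O3 one_O3)

lemma conjugate_Int:
  assumes "a \<in> carrier O3" "H \<subseteq> carrier O3" "K \<subseteq> carrier O3"
  shows "conjugate a (H \<inter> K) = conjugate a H \<inter> conjugate a K"
  unfolding conjugate_image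
  by (rule inj_on_image_Int[of _ "carrier O3"])
    (use assms in \<open>auto simp: inj_on_def simp del: carrier_O3 mult_O3\<close>)

lemma conj_class_conjugate:
  assumes "a \<in> carrier O3" "K \<subseteq> carrier O3"
  shows "conj_class (conjugate a K) = conj_class K"
proof -
  have "\<exists>g'\<in>carrier O3. conjugate g K = conjugate g' (conjugate a K)" if "g \<in> carrier O3" for g
    using assms that
    by (intro bexI[of _ "g \<otimes>\<^bsub>O3\<^esub> inv\<^bsub>O3\<^esub> a"])
      (simp_all add: conjugate_conjugate O3.m_assoc del: carrier_O3 mult_O3 one_O3)
  moreover have "\<exists>g'\<in>carrier O3. conjugate g (conjugate a K) = conjugate g' K"
    if "g \<in> carrier O3" for g
    using assms that
    by (intro bexI[of _ "g \<otimes>\<^bsub>O3\<^esub> a"])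
      (simp_all add: conjugate_conjugate del: carrier_O3 mult_O3)
  ultimately show ?thesis
    unfolding conj_class_def by blast
qed

lemma clips_conj_class:
  assumes "H1 \<subseteq> carrier O3" "H2 \<subseteq> carrier O3"
  shows "conj_class H1 \<circledcirc> conj_class H2 = {conj_class (H1 \<inter> conjugate g H2) |g. g \<in> carrier O3}"
proof (intro equalityI subsetI)
  fix C assume "C \<in> conj_class H1 \<circledcirc> conj_class H2"
  then obtain a b g where *: "a \<in> carrier O3" "b \<in> carrier O3" "g \<in> carrier O3"
    and C: "C = conj_class (conjugate a H1 \<inter> conjugate g (conjugate b H2))"
    unfolding clips_def conj_class_def by blast
  define g' where "g' = inv\<^bsub>O3\<^esub> a \<otimes>\<^bsub>O3\<^esub> (g \<otimes>\<^bsub>O3\<^esub> b)"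
  have g': "g' \<in> carrier O3" "a \<otimes>\<^bsub>O3\<^esub> g' = g \<otimes>\<^bsub>O3\<^esub> b"
    using * by (simp_all add: g'_def O3.m_assoc[symmetric] del: carrier_O3 mult_O3 one_O3)
  have "conjugate a H1 \<inter> conjugate g (conjugate b H2) = conjugate a (H1 \<inter> conjugate g' H2)"
    using * g' assms
    by (simp add: conjugate_Int conjugate_conjugate conjugate_carrier del: carrier_O3 mult_O3)
  then have "C = conj_class (H1 \<inter> conjugate g' H2)"
    using C * assms by (simp add: conj_class_conjugate le_infI1 del: carrier_O3)
  then show "C \<in> {conj_class (H1 \<inter> conjugate g H2) |g. g \<in> carrier O3}"
    using g' by blast
next
  fix C assume "C \<in> {conj_class (H1 \<inter> conjugate g H2) |g. g \<in> carrier O3}"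
  moreover have "H1 \<in> conj_class H1" "H2 \<in> conj_class H2"
    using assms conjugate_one O3.one_closed unfolding conj_class_def by blast+
  ultimately show "C \<in> conj_class H1 \<circledcirc> conj_class H2"
    unfolding clips_def by blast
qed

lemma rotation_works:
  "rotation n \<theta> *v v = (let u = n /\<^sub>R norm n in
    cos \<theta> *\<^sub>R v + sin \<theta> *\<^sub>R cross3 u v + ((1 - cos \<theta>) * (u \<bullet> v)) *\<^sub>R u)"
proof -
  have "linear (\<lambda>v. cos \<theta> *\<^sub>R v + sin \<theta> *\<^sub>R cross3 u v + ((1 - cos \<theta>) * (u \<bullet> v)) *\<^sub>R u)" for u
    by (rule linearI)
      (simp_all add: cross_add_right cross_mult_right inner_add_right scaleR_add_left
         scaleR_add_right distrib_left mult.commute mult.left_commute)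
  from fun_cong[OF matrix_vector_mul(2)[OF this]] show ?thesis
    unfolding rotation_def Let_def .
qed

lemma orthogonal_matrix_rotation:
  assumes "n \<noteq> 0"
  shows "orthogonal_matrix (rotation n \<theta>)"
proof -
  define u where "u = n /\<^sub>R norm n"
  have u: "u \<bullet> u = 1"
    using assms by (simp add: u_def dot_square_norm power2_eq_square)
  have "norm (rotation n \<theta> *v v) = norm v" for v
  proof -
    have 1: "cross3 u v \<bullet> cross3 u v = v \<bullet> v - (u \<bullet> v)\<^sup>2"
      by (simp add: dot_cross u power2_eq_square inner_commute)
    have 2: "v \<bullet> cross3 u v = 0" "u \<bullet> cross3 u v = 0" "cross3 u v \<bullet> v = 0" "cross3 u v \<bullet> u = 0"
      by (simp_all add: dot_cross_self)
    have c: "(cos \<theta>)\<^sup>2 = 1 - (sin \<theta>)\<^sup>2"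
      by (rule cos_squared_eq)
    have "(rotation n \<theta> *v v) \<bullet> (rotation n \<theta> *v v) = 
      (cos \<theta>)\<^sup>2 * (v \<bullet> v) + (sin \<theta>)\<^sup>2 * (v \<bullet> v - (u \<bullet> v)\<^sup>2)
        + (1 - cos \<theta>)\<^sup>2 * (u \<bullet> v)\<^sup>2 + 2 * cos \<theta> * (1 - cos \<theta>) * (u \<bullet> v)\<^sup>2"
      unfolding rotation_works u_def[symmetric] Let_def
      by (simp add: inner_add_left inner_add_right 1 2 u inner_commute[of v u])
        (simp add: power2_eq_square algebra_simps)
    also have "\<dots> = v \<bullet> v"
      using c by algebra
    finally show ?thesis
      by (simp add: norm_eq_sqrt_inner)
  qed
  then have "orthogonal_transformation ((*v) (rotation n \<theta>))"
    by (simp add: orthogonal_transformation)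
  then show ?thesis
    by (simp add: orthogonal_transformation_matrix)
qed

lemma rotation_axis:
  assumes "n \<noteq> 0"
  shows "rotation n \<theta> *v n = n"
proof -
  have "(n /\<^sub>R norm n) \<bullet> n = norm n"
    using assms by (simp add: dot_square_norm power2_eq_square)
  then show ?thesis
    using assms by (simp add: rotation_works cross_mult_left algebra_simps)
qed

lemma rotation_0: "rotation n 0 = mat 1"
  using matrix_id_mat_1 by (simp add: rotation_def id_def)

lemma Z_1: "Z 1 = trivial_group"
  by (simp add: Z_def trivial_group_def rotation_0)

lemma conj_class_Dz_1: "conj_class (Dz 1) = conj_class (Z2k_minus 1)"
proof -
  define A :: "real^3^3" where "A = vector [vector [0,0,1], vector [0,1,0], vector [1,0,0]]"
  have A: "transpose A = A" "A ** A = mat 1"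
    by (simp_all add: A_def transpose_def vec_eq_iff forall_3 matrix_matrix_mult_def sum_3 mat_def)
  then have orth: "A \<in> carrier O3"
    by (simp add: orthogonal_matrix)
  have e: "norm e1 = 1" "norm e3 = 1"
    by simp_all
  have r1: "rotation e1 pi = vector [vector [1,0,0], vector [0,-1,0], vector [0,0,-1]]"
    unfolding rotation_def Let_def e
    by (simp add: vec_eq_iff forall_3 matrix_def cross_components axis_def inner_vec_def sum_3)
  have r3: "rotation e3 pi = vector [vector [-1,0,0], vector [0,-1,0], vector [0,0,1]]"
    unfolding rotation_def Let_def e
    by (simp add: vec_eq_iff forall_3 matrix_def cross_components axis_def inner_vec_def sum_3)
  have "A ** (- rotation e1 pi) ** A = - rotation e3 pi"
    by (simp add: A_def r1 r3 vec_eq_iff forall_3 matrix_matrix_mult_def sum_3)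
  then have "conjugate A (Dz 1) = Z2k_minus 1"
    unfolding Dz_def Z2k_minus_def Z_1
    using A orth by (simp add: conjugate_image trivial_group_def l_coset_def inv_O3)
  moreover have "Dz 1 \<subseteq> carrier O3"
    unfolding Dz_def Z_1
    using orthogonal_matrix_rotation[of e1 pi]
    by (auto simp: trivial_group_def l_coset_def orthogonal_matrix_id)
      (simp add: orthogonal_matrix_def vec_eq_iff transpose_def matrix_matrix_mult_def)
  ultimately show ?thesis
    using conj_class_conjugate[OF orth] by metis
qed

end

theory Submission
  imports Defs
begin

text \<open>
  Fix a conjugate of \<open>\<D>\<^sub>m \<oplus> \<int>\<^sub>2\<^sup>c\<close> by \<open>g\<close>. What \<open>\<circledcirc>\<close> collects are the classes of its intersections
  with \<open>O_minus\<close>, the full symmetry group of a regular tetrahedron (\<open>O_minus_eq\<close>); such an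
  intersection is called \<open>clip g m\<close> below.

  The conjugated group contains \<open>- Id\<close>, so a matrix \<open>A\<close> belongs to it exactly if the rotation
  \<open>det A \<cdot> A\<close> does. That rotation fixes or reverses the main axis \<open>a = g e\<^sub>3\<close>, and in the former case
  membership depends only on its angle: half turns require \<open>2 | m\<close>, thirds of a turn \<open>3 | m\<close> and
  quarter turns \<open>4 | m\<close> (\<open>axis_rotation_in_prism_iff\<close>). The half turns reversing \<open>a\<close> are those about
  \<open>m\<close> axes orthogonal to \<open>a\<close> (\<open>mem_prism_halfturn_iff\<close>).

  If the intersection contains no \<open>A \<noteq> Id\<close> whose rotation fixes \<open>a\<close>, then the product of any two of its
  nontrivial elements, having a rotation that fixes \<open>a\<close>, is \<open>Id\<close>. So the intersection has at most one
  nontrivial element, which is a half turn or a reflection: the class is \<open>[1]\<close>, \<open>[\<int>\<^sub>2]\<close> or \<open>[\<int>\<^sub>2\<^sup>-]\<close>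
  (\<open>small_clip_class\<close>).

  Otherwise \<open>a\<close> is the axis of \<open>det A \<cdot> A\<close> for a nontrivial element \<open>A\<close> of the tetrahedral group, and
  this group moves \<open>a\<close> to the direction of \<open>(0,0,1)\<close>, \<open>(1,-1,0)\<close> or \<open>(1,1,1)\<close>
  (\<open>special_axis_cases\<close>). The elements of \<open>O_minus\<close> preserving such a line form a group of order 8, 4 or 6,
  so that the divisors of \<open>m\<close> and closure under products leave few possibilities
  (\<open>fourfold_axis_clip\<close>, \<open>twofold_axis_clip\<close>, \<open>threefold_axis_clip\<close>). In the first case the axes
  \<open>e\<^sub>1\<close> and \<open>e\<^sub>1 + e\<^sub>2\<close> meet at an angle \<open>\<pi>/4\<close>, which explains the role of \<open>4 | m\<close>: then either all or none
  of the elements reversing \<open>a\<close> survive, whereas for even \<open>m\<close> not divisible by 4 the half turns and the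
  reflections exclude each other.

  Conversely, every listed class is attained by putting \<open>a\<close> along a suitable vector and turning the frame
  about \<open>a\<close> so that one prescribed element is present or absent (\<open>prism_realization\<close>).
\<close>

section \<open>Explicit matrices and vectors\<close>

definition m3 :: "real \<Rightarrow> real \<Rightarrow> real \<Rightarrow> real \<Rightarrow> real \<Rightarrow> real \<Rightarrow> real \<Rightarrow> real \<Rightarrow> real \<Rightarrow> real^3^3"
  where "m3 a b c d e f g h i = vector [vector [a,b,c], vector [d,e,f], vector [g,h,i]]"

definition v3 :: "real \<Rightarrow> real \<Rightarrow> real \<Rightarrow> real^3"
  where "v3 x y z = vector [x,y,z]"

lemma m3_nth [simp]:
  "m3 a b c d e f g h i $ 1 = v3 a b c"
  "m3 a b c d e f g h i $ 2 = v3 d e f"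
  "m3 a b c d e f g h i $ 3 = v3 g h i"
  "v3 x y z $ 1 = x" "v3 x y z $ 2 = y" "v3 x y z $ 3 = z"
  by (simp_all add: m3_def v3_def)

lemma m3_exhaust: "\<exists>a b c d e f g h i. A = m3 a b c d e f g h i"
  by (rule exI[of _ "A$1$1"], rule exI[of _ "A$1$2"], rule exI[of _ "A$1$3"],
      rule exI[of _ "A$2$1"], rule exI[of _ "A$2$2"], rule exI[of _ "A$2$3"],
      rule exI[of _ "A$3$1"], rule exI[of _ "A$3$2"], rule exI[of _ "A$3$3"])
    (simp add: vec_eq_iff forall_3)

lemma v3_exhaust: "\<exists>x y z. v = v3 x y z"
  by (rule exI[of _ "v$1"], rule exI[of _ "v$2"], rule exI[of _ "v$3"])
    (simp add: vec_eq_iff forall_3)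

lemma m3_arith:
  "m3 a b c d e f g h i ** m3 a' b' c' d' e' f' g' h' i' =
    m3 (a*a' + b*d' + c*g') (a*b' + b*e' + c*h') (a*c' + b*f' + c*i')
       (d*a' + e*d' + f*g') (d*b' + e*e' + f*h') (d*c' + e*f' + f*i')
       (g*a' + h*d' + i*g') (g*b' + h*e' + i*h') (g*c' + h*f' + i*i')"
  "m3 a b c d e f g h i *v v3 x y z = v3 (a*x + b*y + c*z) (d*x + e*y + f*z) (g*x + h*y + i*z)"
  "- m3 a b c d e f g h i = m3 (-a) (-b) (-c) (-d) (-e) (-f) (-g) (-h) (-i)"
  "r *\<^sub>R m3 a b c d e f g h i = m3 (r*a) (r*b) (r*c) (r*d) (r*e) (r*f) (r*g) (r*h) (r*i)"
  "- v3 x y z = v3 (-x) (-y) (-z)"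
  "r *\<^sub>R v3 x y z = v3 (r*x) (r*y) (r*z)"
  "transpose (m3 a b c d e f g h i) = m3 a d g b e h c f i"
  "mat 1 = m3 1 0 0 0 1 0 0 0 1"
  "axis 1 1 = v3 1 0 0" "axis 2 1 = v3 0 1 0" "axis 3 1 = v3 0 0 1"
  "det (m3 a b c d e f g h i) = a*e*i + b*f*g + c*d*h - a*f*h - b*d*i - c*e*g"
  "trace (m3 a b c d e f g h i) = a + e + i"
  "v3 x y z \<bullet> v3 x' y' z' = x*x' + y*y' + z*z'"
  by (simp_all add: vec_eq_iff forall_3 matrix_matrix_mult_def matrix_vector_mult_def sum_3
      transpose_def mat_def axis_def det_3 trace_def inner_vec_def)

lemma m3_eq_iff:
  "(m3 a b c d e f g h i = m3 a' b' c' d' e' f' g' h' i') \<longleftrightarrow>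
     a = a' \<and> b = b' \<and> c = c' \<and> d = d' \<and> e = e' \<and> f = f' \<and> g = g' \<and> h = h' \<and> i = i'"
  "(v3 x y z = v3 x' y' z') \<longleftrightarrow> x = x' \<and> y = y' \<and> z = z'"
  by (metis m3_nth)+

lemmas m3_simps = m3_arith m3_eq_iff

lemma v3_add: "v3 x y z + v3 x' y' z' = v3 (x+x') (y+y') (z+z')"
  by (simp add: vec_eq_iff forall_3)

section \<open>Rotations about the third axis\<close>

text \<open>
  The parameter is the complex number \<open>cis \<theta>\<close> in place of the angle \<open>\<theta>\<close>: composition becomes complex
  multiplication, and the rotations in \<open>\<int>\<^sub>k\<close> correspond to the \<open>k\<close>-th roots of unity.
\<close>

definition rotz :: "complex \<Rightarrow> real^3^3"
  where "rotz z = m3 (Re z) (- Im z) 0 (Im z) (Re z) 0 0 0 1"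

definition flip :: "real^3^3"
  where "flip = m3 1 0 0 0 (-1) 0 0 0 (-1)"

text \<open>
  Rodrigues' formula in coordinates.
\<close>

lemma rotation_m3:
  assumes "n /\<^sub>R norm n = v3 a b c"
  shows "rotation n \<theta> = m3
    (cos \<theta> + (1 - cos \<theta>)*a*a) ((1 - cos \<theta>)*a*b - sin \<theta>*c) ((1 - cos \<theta>)*a*c + sin \<theta>*b)
    ((1 - cos \<theta>)*a*b + sin \<theta>*c) (cos \<theta> + (1 - cos \<theta>)*b*b) ((1 - cos \<theta>)*b*c - sin \<theta>*a)
    ((1 - cos \<theta>)*a*c - sin \<theta>*b) ((1 - cos \<theta>)*b*c + sin \<theta>*a) (cos \<theta> + (1 - cos \<theta>)*c*c)"
  unfolding rotation_def Let_def assms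
  by (simp add: vec_eq_iff forall_3 matrix_def cross_components axis_def inner_vec_def sum_3)

lemma rotation_e3: "rotation e3 \<theta> = rotz (cis \<theta>)"
  by (subst rotation_m3[where a = 0 and b = 0 and c = 1]) (simp_all add: m3_simps rotz_def norm_eq_sqrt_inner)

lemma rotation_e1_pi: "rotation e1 pi = flip"
  by (subst rotation_m3[where a = 1 and b = 0 and c = 0]) (simp_all add: m3_simps flip_def norm_eq_sqrt_inner)

lemma rotation_diagonal: "rotation (e1 + e2 + e3) (2 * pi / 3) = m3 0 0 1 1 0 0 0 1 0"
proof -
  have v: "e1 + e2 + e3 = v3 1 1 1" by (simp add: m3_simps v3_add)
  have n: "norm (v3 1 1 1) = sqrt 3" by (simp add: norm_eq_sqrt_inner m3_simps)
  have "(e1 + e2 + e3) /\<^sub>R norm (e1 + e2 + e3) = v3 (1/sqrt 3) (1/sqrt 3) (1/sqrt 3)"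
    unfolding v n by (simp add: m3_simps divide_inverse)
  from rotation_m3[OF this] show ?thesis
    by (simp add: m3_simps cos_120 sin_120)
qed

lemma rotz_mult: "rotz z ** rotz w = rotz (z * w)"
  by (simp add: rotz_def m3_simps algebra_simps)

lemma flip_rotz: "flip ** rotz z = rotz (cnj z) ** flip"
  and flip_flip: "flip ** flip = mat 1"
  and rotz_1: "rotz 1 = mat 1"
  and transpose_rotz: "transpose (rotz z) = rotz (cnj z)"
  and transpose_flip: "transpose flip = flip"
  by (simp_all add: rotz_def flip_def m3_simps)

lemma orthogonal_rotz: "cmod z = 1 \<Longrightarrow> orthogonal_matrix (rotz z)"
  and orthogonal_flip: "orthogonal_matrix flip"
  using complex_norm_square[of z, symmetric]
  by (simp_all add: orthogonal_matrix_def transpose_rotz transpose_flip rotz_mult flip_flip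
     rotz_1 mult.commute)

lemma orthogonal_uminus: "orthogonal_matrix (A :: real^3^3) \<Longrightarrow> orthogonal_matrix (- A)"
  by (simp add: orthogonal_matrix_def vec_eq_iff transpose_def matrix_matrix_mult_def)

lemma cmod_root_unity: "z ^ n = 1 \<Longrightarrow> n > 0 \<Longrightarrow> cmod z = 1"
  by (metis norm_one norm_power power_eq_1_iff norm_ge_zero gr_implies_not0)

lemma Z_eq:
  assumes "k > 0"
  shows "Z k = rotz ` {z. z ^ k = 1}"
proof -
  have "Z k = rotz ` (\<lambda>j. cis (2 * pi * real j / real k)) ` {..<k}"
    unfolding Z_def rotation_e3 by (auto simp: mult_ac)
  then show ?thesis
    unfolding bij_betw_imp_surj_on[OF Complex.bij_betw_roots_unity[OF assms]] .
qed

lemma rotz_flip_mult: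
  "rotz z ** flip ** rotz w = rotz (z * cnj w) ** flip"
  "rotz z ** flip ** (rotz w ** flip) = rotz (z * cnj w)"
  by (metis flip_rotz matrix_mul_assoc rotz_mult,
      metis flip_rotz matrix_mul_assoc rotz_mult flip_flip matrix_mul_rid)

text \<open>
  The right-hand side is closed under products because \<open>flip\<close> conjugates a rotation about \<open>e\<^sub>3\<close> to its
  inverse. Its second part consists of the half turns about \<open>m\<close> axes in the plane of \<open>e\<^sub>1\<close> and \<open>e\<^sub>2\<close>.
\<close>

lemma D_eq:
  assumes "m > 0"
  shows "D m = rotz ` {z. z ^ m = 1} \<union> (\<lambda>z. rotz z ** flip) ` {z. z ^ m = 1}" (is "_ = ?X")
proof (intro equalityI subsetI)
  have root: "cis (2 * pi / real m) ^ m = 1"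
    using assms by (simp add: Complex.DeMoivre)
  have orth: "orthogonal_matrix (rotz z)" if "z ^ m = 1" for z
    using that assms by (intro orthogonal_rotz cmod_root_unity) auto
  fix A assume "A \<in> D m"
  then show "A \<in> ?X"
    unfolding D_def
  proof (induction rule: generate.induct)
    case one
    then show ?case by (auto simp: rotz_1[symmetric])
  next
    case (incl h)
    then show ?case
      using root rotz_1 by (auto simp: rotation_e3 rotation_e1_pi image_iff intro: exI[of _ 1])
  next
    case (inv h)
    then consider "h = rotz (cis (2 * pi / real m))" | "h = flip"
      by (auto simp: rotation_e3 rotation_e1_pi)
    then show ?case
    proof cases
      case 1
      then show ?thesis
        using root orth[OF root]
        by (auto simp: inv_O3 transpose_rotz simp flip: complex_cnj_power)
    next
      case 2
      then show ?thesis
        using rotz_1 by (auto simp: inv_O3 orthogonal_flip transpose_flip image_iff intro: exI[of _ 1])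
    qed
  next
    case (eng h1 h2)
    have roots: "(z * cnj w) ^ m = 1" "(z * w) ^ m = 1" if "z ^ m = 1" "w ^ m = 1" for z w
      using that by (simp_all add: power_mult_distrib flip: complex_cnj_power)
    have prods: "rotz z ** rotz w \<in> ?X" "rotz z ** (rotz w ** flip) \<in> ?X"
        "rotz z ** flip ** rotz w \<in> ?X" "rotz z ** flip ** (rotz w ** flip) \<in> ?X"
      if "z ^ m = 1" "w ^ m = 1" for z w
      unfolding matrix_mul_assoc[of "rotz z" "rotz w"] rotz_mult rotz_flip_mult
      using roots[OF that] by blast+
    from eng(3,4) show ?case
      unfolding mult_O3 by (elim UnE imageE CollectE) (simp_all only: prods)
  qed
next
  have gen: "rotation e3 (2 * pi / real m) \<in> D m" "flip \<in> D m" "rotz 1 \<in> D m"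
    unfolding D_def rotation_e1_pi rotz_1
    using generate.one[of O3] by (auto intro: generate.incl)
  have mult: "A ** B \<in> D m" if "A \<in> D m" "B \<in> D m" for A B
    using that generate.eng[of _ O3] unfolding D_def by auto
  have "rotz (cis (2 * pi / real m) ^ j) \<in> D m" for j
    by (induction j) (use gen mult in \<open>simp_all add: rotation_e3 flip: rotz_mult\<close>)
  then have "rotation e3 (2 * real j * pi / real m) \<in> D m" for j
    by (simp add: rotation_e3 Complex.DeMoivre mult_ac)
  then have "Z m \<subseteq> D m"
    by (auto simp: Z_def)
  then have "rotz z \<in> D m" if "z ^ m = 1" for z
    using that assms by (auto simp: Z_eq)
  then show "A \<in> D m" if "A \<in> ?X" for A
    using that gen mult by auto
qed

section \<open>Membership in a conjugate of a prism group\<close>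

text \<open>
  For orthogonal \<open>A\<close> this is the one of \<open>A\<close> and \<open>- A\<close> that lies in \<open>SO(3)\<close>. It serves to treat proper and
  improper elements alike, as \<open>- Id\<close> belongs to every conjugate of \<open>\<D>\<^sub>m \<oplus> \<int>\<^sub>2\<^sup>c\<close>.
\<close>

definition rotpart :: "real^3^3 \<Rightarrow> real^3^3"
  where "rotpart A = det A *\<^sub>R A"

text \<open>
  These groups are the symmetry groups of prisms or antiprisms over a regular \<open>m\<close>-gon; the main axis is the
  line of \<open>g e\<^sub>3\<close>.
\<close>

definition prism :: "real^3^3 \<Rightarrow> nat \<Rightarrow> (real^3^3) set"
  where "prism g m = conjugate g (with_Z2c (D m))"

lemma mem_conjugate_iff:
  assumes "orthogonal_matrix g"
  shows "A \<in> conjugate g H \<longleftrightarrow> transpose g ** A ** g \<in> H"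
proof -
  have g: "transpose g ** g = mat 1" "g ** transpose g = mat 1"
    using assms by (auto simp: orthogonal_matrix_def)
  have "transpose g ** (g ** h ** transpose g) ** g = h" 
       "g ** (transpose g ** h ** g) ** transpose g = h" for h
    by (metis g matrix_mul_assoc matrix_mul_lid matrix_mul_rid)+
  then show ?thesis
    using assms unfolding conjugate_image by (simp add: inv_O3 image_iff) metis
qed

lemma det_uminus_3: "det (- A :: real^3^3) = - det A"
  by (simp add: det_3)

lemma rotpart_cases:
  assumes "orthogonal_matrix A"
  obtains "det A = 1" "rotpart A = A" | "det A = - 1" "rotpart A = - A"
  using det_orthogonal_matrix[OF assms] by (auto simp: rotpart_def)

lemma rotpart_props:
  assumes "orthogonal_matrix A"
  shows "orthogonal_matrix (rotpart A)" "det (rotpart A) = 1"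
  using assms by (cases rule: rotpart_cases[OF assms]; simp add: orthogonal_uminus det_uminus_3)+

lemma det_D: "m > 0 \<Longrightarrow> A \<in> D m \<Longrightarrow> det A = 1"
proof -
  have "det (rotz z) = 1" if "cmod z = 1" for z
    using that complex_norm_square[of z] by (simp add: rotz_def m3_simps cmod_def power2_eq_square)
  moreover have "det flip = 1" by (simp add: flip_def m3_simps)
  ultimately show "m > 0 \<Longrightarrow> A \<in> D m \<Longrightarrow> det A = 1"
    using cmod_root_unity by (fastforce simp: D_eq det_mul)
qed

lemma mem_prism_iff:
  assumes "orthogonal_matrix g" "orthogonal_matrix A" "m > 0"
  shows "A \<in> prism g m \<longleftrightarrow> transpose g ** rotpart A ** g \<in> D m"
proof -
  define B where "B = transpose g ** A ** g"
  have "det g = 1 \<or> det g = - 1" using assms det_orthogonal_matrix by blast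
  then have d: "det B = det A"
    by (auto simp: B_def det_mul det_transpose)
  have *: "transpose g ** (- A) ** g = - B"
    by (simp add: B_def vec_eq_iff matrix_matrix_mult_def sum_negf sum_distrib_left)
  have "B \<in> with_Z2c (D m) \<longleftrightarrow> B \<in> D m \<or> - B \<in> D m"
    unfolding with_Z2c_def by (force simp: image_iff)
  moreover have "B \<in> D m \<Longrightarrow> det A = 1" "- B \<in> D m \<Longrightarrow> det A = - 1"
    using det_D[OF assms(3), of B] det_D[OF assms(3), of "- B"] d by (auto simp: det_uminus_3)
  ultimately show ?thesis
    unfolding prism_def mem_conjugate_iff[OF assms(1)]
    by (cases rule: rotpart_cases[OF assms(2)]) (auto simp: * B_def)
qed

text \<open>
  Orthogonality makes the last row equal to the last column, and in the upper left block
  \<open>(a, b; d, e)\<close> one has \<open>(a - e)\<^sup>2 + (b + d)\<^sup>2 = 2 - 2 (a e - b d) = 0\<close>.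
\<close>

lemma axis_rotation_eq_rotz:
  assumes "orthogonal_matrix B" "det B = 1" "B *v e3 = e3"
  obtains z where "cmod z = 1" "B = rotz z"
proof -
  obtain a b c d e f g h i where B: "B = m3 a b c d e f g h i"
    using m3_exhaust by blast
  have 1: "c = 0" "f = 0" "i = 1"
    using assms(3) by (simp_all add: B m3_simps)
  have eqs: "g\<^sup>2 + h\<^sup>2 + i\<^sup>2 = 1" "a\<^sup>2 + d\<^sup>2 + g\<^sup>2 = 1" "b\<^sup>2 + e\<^sup>2 + h\<^sup>2 = 1"
    using assms(1) by (simp_all add: orthogonal_matrix_def B m3_simps power2_eq_square)
  then have 2: "g = 0" "h = 0"
    using 1 by (simp_all add: sum_power2_eq_zero_iff)
  have "a * e - b * d = 1"
    using assms(2) 1 2 by (simp add: B m3_simps)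
  then have "(a - e)\<^sup>2 + (b + d)\<^sup>2 = 0"
    using eqs 2 by (simp add: power2_eq_square algebra_simps)
  then have "e = a" "b = - d"
    by (simp_all add: sum_power2_eq_zero_iff)
  then have "B = rotz (Complex a d)" "cmod (Complex a d) = 1"
    using 1 2 eqs by (simp_all add: B rotz_def cmod_def)
  then show thesis using that by blast
qed

lemma reversing_rotation_eq_rotz_flip:
  assumes "orthogonal_matrix B" "det B = 1" "B *v e3 = - e3"
  obtains z where "cmod z = 1" "B = rotz z ** flip"
proof -
  have "(B ** flip) *v e3 = B *v (flip *v e3)"
    by (simp add: matrix_vector_mul_assoc)
  also have "flip *v e3 = - e3"
    by (simp add: flip_def m3_simps)
  finally have "(B ** flip) *v e3 = e3"
    using assms(3) by (simp add: linear_neg)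
  moreover have "orthogonal_matrix (B ** flip)" "det (B ** flip) = 1"
    using assms orthogonal_flip by (simp_all add: orthogonal_matrix_mul det_mul flip_def m3_simps)
  ultimately obtain z where "cmod z = 1" "B ** flip = rotz z"
    using axis_rotation_eq_rotz by metis
  moreover have "B ** flip ** flip = B"
    by (metis flip_flip matrix_mul_assoc matrix_mul_rid)
  ultimately show thesis using that by metis
qed

lemma rotz_eq_iff [simp]: "rotz z = rotz w \<longleftrightarrow> z = w" "rotz z ** flip = rotz w ** flip \<longleftrightarrow> z = w"
  and rotz_neq_flip [simp]: "rotz z \<noteq> rotz w ** flip" "rotz w ** flip \<noteq> rotz z"
  by (auto simp: rotz_def flip_def m3_simps complex_eq_iff)

lemma rotz_e3: "rotz z *v e3 = e3"
  and rotz_flip_e3: "(rotz z ** flip) *v e3 = - e3"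
  by (simp_all add: rotz_def flip_def m3_simps)

lemma conj_matrix_vec_iff:
  assumes "orthogonal_matrix (g :: real^3^3)" 
  shows "(transpose g ** A ** g) *v v = w \<longleftrightarrow> A *v (g *v v) = g *v w"
proof -
  have g: "transpose g ** g = mat 1" "g ** transpose g = mat 1"
    using assms by (auto simp: orthogonal_matrix_def)
  then have "transpose g *v (g *v x) = x" "g *v (transpose g *v x) = x" for x
    by (simp_all only: matrix_vector_mul_assoc matrix_vector_mul_lid)
  then show ?thesis
    by (metis matrix_vector_mul_assoc)
qed

lemma conj_rotation:
  assumes "orthogonal_matrix (g :: real^3^3)" "orthogonal_matrix A" "det A = 1"
  shows "orthogonal_matrix (transpose g ** A ** g)" "det (transpose g ** A ** g) = 1"
  using assms det_orthogonal_matrix[OF assms(1)]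
  by (auto simp: orthogonal_matrix_mul orthogonal_matrix_transpose det_mul det_transpose)

lemma prism_axis:
  assumes "orthogonal_matrix g" "orthogonal_matrix A" "m > 0" "A \<in> prism g m"
  shows "rotpart A *v (g *v e3) = g *v e3 \<or> rotpart A *v (g *v e3) = - (g *v e3)"
proof -
  have "transpose g ** rotpart A ** g \<in> D m"
    using assms mem_prism_iff by blast
  then have "(transpose g ** rotpart A ** g) *v e3 = e3 \<or> (transpose g ** rotpart A ** g) *v e3 = - e3"
    using assms(3) by (auto simp: D_eq rotz_e3 rotz_flip_e3)
  then show ?thesis
    unfolding conj_matrix_vec_iff[OF assms(1)] by (simp add: linear_neg)
qed

text \<open>
  The trace determines the angle of a rotation up to sign, hence \<open>z\<close> up to complex conjugation, and the
  condition \<open>z ^ m = 1\<close> is invariant under conjugation.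
\<close>

lemma mem_prism_rotation_iff:
  assumes "orthogonal_matrix g" "orthogonal_matrix A" "m > 0"
    and "rotpart A *v (g *v e3) = g *v e3" "cmod z = 1" "trace (rotpart A) = 1 + 2 * Re z"
  shows "A \<in> prism g m \<longleftrightarrow> z ^ m = 1"
proof -
  let ?B = "transpose g ** rotpart A ** g"
  obtain w where w: "cmod w = 1" "?B = rotz w"
    using conj_rotation[OF assms(1) rotpart_props[OF assms(2)]] assms(4)
    by (metis axis_rotation_eq_rotz conj_matrix_vec_iff[OF assms(1)])
  have "trace ?B = trace (rotpart A)"
    using assms(1) by (metis trace_mul_sym matrix_mul_assoc orthogonal_matrix_def matrix_mul_lid)
  then have "Re w = Re z"
    by (simp add: w assms(6)) (simp add: rotz_def m3_simps)
  moreover from this have "(Im w)\<^sup>2 = (Im z)\<^sup>2"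
    using w(1) assms(5) by (simp add: cmod_def)
  ultimately have "w = z \<or> w = cnj z"
    by (auto simp: complex_eq_iff power2_eq_iff)
  then have "w ^ m = 1 \<longleftrightarrow> z ^ m = 1"
    by (metis complex_cnj_power complex_cnj_one complex_cnj_cnj)
  then show ?thesis
    using assms(3) by (auto simp: mem_prism_iff[OF assms(1-3)] w(2) D_eq)
qed

text \<open>
  In the frame \<open>g\<close> the rotation is the half turn about the direction \<open>w\<close> of the horizontal plane. It is
  the reflection of that plane in the line of \<open>w\<close>, that is \<open>u \<mapsto> w\<^sup>2 * cnj u\<close>, and equals \<open>rotz (w\<^sup>2) ** flip\<close>.
\<close>

lemma mem_prism_halfturn_iff:
  assumes "orthogonal_matrix g" "orthogonal_matrix A" "m > 0"
    and "rotpart A *v (g *v e3) = - (g *v e3)"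
    and "cmod w = 1" "rotpart A *v (g *v v3 (Re w) (Im w) 0) = g *v v3 (Re w) (Im w) 0"
  shows "A \<in> prism g m \<longleftrightarrow> w ^ (2 * m) = 1"
proof -
  let ?B = "transpose g ** rotpart A ** g"
  have "?B *v e3 = - e3"
    unfolding conj_matrix_vec_iff[OF assms(1)] by (simp add: assms(4) linear_neg)
  then obtain z where z: "cmod z = 1" "?B = rotz z ** flip"
    using conj_rotation[OF assms(1) rotpart_props[OF assms(2)]] reversing_rotation_eq_rotz_flip by metis
  have "?B *v v3 (Re w) (Im w) 0 = v3 (Re w) (Im w) 0"
    unfolding conj_matrix_vec_iff[OF assms(1)] by (simp add: assms(6))
  then have "z * cnj w = w"
    unfolding z(2) by (simp add: rotz_def flip_def m3_simps complex_eq_iff)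
  then have "z = w\<^sup>2"
    using assms(5) complex_norm_square[of w] 
    by (metis mult.assoc mult.commute mult_1 norm_one of_real_1 power2_eq_square one_power2)
  then show ?thesis
    using assms(3) by (auto simp: mem_prism_iff[OF assms(1-3)] z(2) D_eq power_mult)
qed

section \<open>The full tetrahedral group\<close>

definition tetra_vertices :: "(real^3) set"
  where "tetra_vertices = {v3 1 1 1, v3 1 (-1) (-1), v3 (-1) 1 (-1), v3 (-1) (-1) 1}"

definition tetra_stab :: "(real^3^3) set"
  where "tetra_stab = {A. orthogonal_matrix A \<and> (*v) A ` tetra_vertices = tetra_vertices}"

text \<open>
  The signed permutation matrices for which the product of the three signs is \<open>1\<close>.
\<close>

definition even_signed_perms :: "(real^3^3) set"
  where "even_signed_perms = (\<Union>s\<in>{1,-1}. \<Union>t\<in>{1,-1}.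
    {m3 s 0 0 0 t 0 0 0 (s*t), m3 0 s 0 0 0 t (s*t) 0 0, m3 0 0 s t 0 0 0 (s*t) 0,
     m3 0 s 0 t 0 0 0 0 (s*t), m3 s 0 0 0 0 t 0 (s*t) 0, m3 0 0 s 0 t 0 (s*t) 0 0})"

lemma tetra_stab_subgroup: "subgroup tetra_stab O3"
proof (rule O3.subgroupI)
  show "tetra_stab \<subseteq> carrier O3" "tetra_stab \<noteq> {}"
    by (auto simp: tetra_stab_def orthogonal_matrix_id intro: exI[of _ "mat 1"])
next
  fix A assume A: "A \<in> tetra_stab"
  then have "transpose A ** A = mat 1"
    by (simp add: tetra_stab_def orthogonal_matrix_def)
  then have "(*v) (transpose A) ` (*v) A ` tetra_vertices = tetra_vertices"
    unfolding image_image matrix_vector_mul_assoc by simp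
  with A show "inv\<^bsub>O3\<^esub> A \<in> tetra_stab"
    by (simp add: tetra_stab_def inv_O3 orthogonal_matrix_transpose del: transpose_matrix_vector)
next
  fix A B assume AB: "A \<in> tetra_stab" "B \<in> tetra_stab"
  have "(*v) (A ** B) ` tetra_vertices = (*v) A ` (*v) B ` tetra_vertices"
    by (simp add: image_image matrix_vector_mul_assoc)
  with AB show "A \<otimes>\<^bsub>O3\<^esub> B \<in> tetra_stab"
    by (simp add: tetra_stab_def orthogonal_matrix_mul)
qed

lemma minus_quarter_turn: "- rotation e3 (pi / 2) = m3 0 1 0 (-1) 0 0 0 0 (-1)"
  unfolding rotation_e3 by (simp add: rotz_def m3_simps)

lemma half_turn_e3: "rotation e3 pi = m3 (-1) 0 0 0 (-1) 0 0 0 1"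
  unfolding rotation_e3 by (simp add: rotz_def m3_simps)

lemma O_minus_subset_stab: "O_minus \<subseteq> tetra_stab"
proof -
  have gens: "{rotation e3 pi, flip, m3 0 0 1 1 0 0 0 1 0, - rotation e3 (pi / 2)} \<subseteq> tetra_stab"
    unfolding half_turn_e3 minus_quarter_turn
    by (auto simp: flip_def tetra_stab_def orthogonal_matrix_def m3_simps tetra_vertices_def)
  then have "T \<subseteq> tetra_stab"
    unfolding T_def rotation_e1_pi rotation_diagonal
    by (intro O3.generate_subgroup_incl tetra_stab_subgroup) auto
  then show ?thesis
    using gens subgroup.m_closed[OF tetra_stab_subgroup]
    by (auto simp: O_minus_def l_coset_def)
qed

text \<open>
  A matrix is determined by the images of three vertices, which are distinct vertices; this leaves 24
  possibilities.
\<close>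

lemma stab_subset_signed_perms: "tetra_stab \<subseteq> even_signed_perms"
proof
  fix A assume A: "A \<in> tetra_stab"
  define p q r where "p = A *v v3 1 1 1" and "q = A *v v3 1 (-1) (-1)" and "r = A *v v3 (-1) 1 (-1)"
  obtain a b c d e f g h i where m3: "A = m3 a b c d e f g h i"
    using m3_exhaust by blast
  have 1: "A = m3 ((p$1 + q$1)/2) ((p$1 + r$1)/2) (- (q$1 + r$1)/2)
                 ((p$2 + q$2)/2) ((p$2 + r$2)/2) (- (q$2 + r$2)/2)
                 ((p$3 + q$3)/2) ((p$3 + r$3)/2) (- (q$3 + r$3)/2)"
    by (simp add: p_def q_def r_def m3 m3_simps)
  have "(*v) A ` tetra_vertices = tetra_vertices"
    using A by (simp add: tetra_stab_def)
  then have 2: "p \<in> tetra_vertices" "q \<in> tetra_vertices" "r \<in> tetra_vertices"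
    by (auto simp: p_def q_def r_def tetra_vertices_def)
  have inj: "x = y" if "A *v x = A *v y" for x y
    using A that
    by (auto simp: tetra_stab_def orthogonal_matrix_def)
       (metis matrix_vector_mul_assoc matrix_vector_mul_lid)
  have 3: "p \<noteq> q" "p \<noteq> r" "q \<noteq> r"
    unfolding p_def q_def r_def by (auto dest!: inj simp: m3_simps)
  from 2 3 show "A \<in> even_signed_perms"
    unfolding 1 tetra_vertices_def
    by (elim insertE emptyE; simp add: even_signed_perms_def m3_simps)
qed

text \<open>
  The matrices with an even permutation are diagonal elements of \<open>T\<close> times powers of the rotation of order
  three; multiplication by the improper generator exchanges them with those having an odd permutation.
\<close>

lemma signed_perms_subset_O_minus: "even_signed_perms \<subseteq> O_minus"
proof -
  let ?P = "m3 0 0 1 1 0 0 0 1 0"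
  have gens: "mat 1 \<in> T" "rotation e3 pi \<in> T" "flip \<in> T" "?P \<in> T"
    unfolding T_def rotation_e1_pi rotation_diagonal
    using generate.one[of O3] by (auto intro: generate.incl)
  have mult: "A ** B \<in> T" if "A \<in> T" "B \<in> T" for A B
    using that generate.eng[of _ O3] unfolding T_def by auto
  have diag: "m3 s 0 0 0 t 0 0 0 (s*t) \<in> T" if "s \<in> {1,-1}" "t \<in> {1,-1}" for s t
    using that gens mult[OF gens(2,3)] unfolding half_turn_e3 flip_def
    by (auto simp: m3_simps)
  have cyc: "m3 0 s 0 0 0 t (s*t) 0 0 \<in> T" "m3 0 0 s t 0 0 0 (s*t) 0 \<in> T"
    if "s \<in> {1,-1}" "t \<in> {1,-1}" for s t
    using mult[OF diag[OF that] gens(4)] mult[OF mult[OF diag[OF that] gens(4)] gens(4)]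
    by (simp_all add: m3_simps)
  have coset: "A \<in> O_minus" if "A \<in> T" for A
    using that by (simp add: O_minus_def)
  have coset': "m3 0 1 0 (-1) 0 0 0 0 (-1) ** A \<in> O_minus" if "A \<in> T" for A
    using that by (auto simp: O_minus_def minus_quarter_turn l_coset_def)
  have odd: "m3 0 s 0 t 0 0 0 0 (s*t) \<in> O_minus" "m3 s 0 0 0 0 t 0 (s*t) 0 \<in> O_minus" 
      "m3 0 0 s 0 t 0 (s*t) 0 0 \<in> O_minus"
    if st: "s \<in> {1,-1}" "t \<in> {1,-1}" for s t
    using coset'[OF diag[of "-t" s]] coset'[OF cyc(1)[of "-t" s]] coset'[OF cyc(2)[of "-t" s]] st
    by (auto simp: m3_simps)
  show ?thesis
    unfolding even_signed_perms_def
    by (intro UN_least insert_subset[THEN iffD2] conjI empty_subsetI coset[OF diag] coset[OF cyc(1)]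
        coset[OF cyc(2)] odd; assumption)
qed

lemma O_minus_eq: "O_minus = tetra_stab" "O_minus = even_signed_perms"
  using O_minus_subset_stab stab_subset_signed_perms signed_perms_subset_O_minus by blast+

lemma O_minus_elems: "O_minus = {
    m3 (-1) 0 0 0 (-1) 0 0 0 1, m3 0 (-1) 0 0 0 (-1) 1 0 0, m3 0 0 (-1) (-1) 0 0 0 1 0,
    m3 0 (-1) 0 (-1) 0 0 0 0 1, m3 (-1) 0 0 0 0 (-1) 0 1 0, m3 0 0 (-1) 0 (-1) 0 1 0 0,
    m3 (-1) 0 0 0 1 0 0 0 (-1), m3 0 (-1) 0 0 0 1 (-1) 0 0, m3 0 0 (-1) 1 0 0 0 (-1) 0,
    m3 0 (-1) 0 1 0 0 0 0 (-1), m3 (-1) 0 0 0 0 1 0 (-1) 0, m3 0 0 (-1) 0 1 0 (-1) 0 0,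
    m3 1 0 0 0 (-1) 0 0 0 (-1), m3 0 1 0 0 0 (-1) (-1) 0 0, m3 0 0 1 (-1) 0 0 0 (-1) 0,
    m3 0 1 0 (-1) 0 0 0 0 (-1), m3 1 0 0 0 0 (-1) 0 (-1) 0, m3 0 0 1 0 (-1) 0 (-1) 0 0,
    m3 1 0 0 0 1 0 0 0 1, m3 0 1 0 0 0 1 1 0 0, m3 0 0 1 1 0 0 0 1 0,
    m3 0 1 0 1 0 0 0 0 1, m3 1 0 0 0 0 1 0 1 0, m3 0 0 1 0 1 0 1 0 0}"
  unfolding O_minus_eq(2) even_signed_perms_def by simp

lemma O_minus_subgroup: "subgroup O_minus O3"
  using tetra_stab_subgroup O_minus_eq by simp

definition axis_stab :: "real^3 \<Rightarrow> (real^3^3) set"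
  where "axis_stab a = {A \<in> O_minus. rotpart A *v a = a \<or> rotpart A *v a = - a}"

text \<open>
  Rewriting with these rules evaluates a predicate on an explicitly given finite set. The union keeps the
  term linear in the size of the set: a conditional around the whole recursive call would occur twice.
\<close>

lemma filter_insert_set:
  "{x \<in> insert a S. P x} = (if P a then {a} else {}) \<union> {x \<in> S. P x}"
  "{x \<in> {}. P x} = {}"
  by auto

text \<open>
  The first three vectors represent the three kinds of axes of the rotations coming from \<open>O_minus\<close>. The
  last three are chosen such that no nontrivial such rotation fixes them, and none, one half turn,
  respectively one negated reflection reverses them.
\<close>

lemma axis_stab_eq:
  "axis_stab (v3 0 0 1) = {
    m3 0 1 0 1 0 0 0 0 1, m3 1 0 0 0 1 0 0 0 1, m3 0 1 0 (-1) 0 0 0 0 (-1),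
    m3 1 0 0 0 (-1) 0 0 0 (-1), m3 0 (-1) 0 1 0 0 0 0 (-1), m3 (-1) 0 0 0 1 0 0 0 (-1),
    m3 0 (-1) 0 (-1) 0 0 0 0 1, m3 (-1) 0 0 0 (-1) 0 0 0 1}"
  "axis_stab (v3 1 (-1) 0) = {
    m3 0 1 0 1 0 0 0 0 1, m3 1 0 0 0 1 0 0 0 1, m3 0 (-1) 0 (-1) 0 0 0 0 1,
    m3 (-1) 0 0 0 (-1) 0 0 0 1}"
  "axis_stab (v3 1 1 1) = {
    m3 0 0 1 0 1 0 1 0 0, m3 1 0 0 0 0 1 0 1 0, m3 0 1 0 1 0 0 0 0 1,
    m3 0 0 1 1 0 0 0 1 0, m3 0 1 0 0 0 1 1 0 0, m3 1 0 0 0 1 0 0 0 1}"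
  "axis_stab (v3 1 2 4) = {
    m3 1 0 0 0 1 0 0 0 1}"
  "axis_stab (v3 1 2 0) = {
    m3 1 0 0 0 1 0 0 0 1, m3 (-1) 0 0 0 (-1) 0 0 0 1}"
  "axis_stab (v3 1 1 3) = {
    m3 0 1 0 1 0 0 0 0 1, m3 1 0 0 0 1 0 0 0 1}"
  unfolding axis_stab_def O_minus_elems filter_insert_set rotpart_def m3_simps
  by simp_all

definition conj_axis :: "real^3 \<Rightarrow> real^3 \<Rightarrow> bool"
  where "conj_axis a b \<longleftrightarrow> (\<exists>t\<in>O_minus. \<exists>c. c \<noteq> 0 \<and> t *v a = c *\<^sub>R b)"

text \<open>
  The rotations \<open>rotpart A\<close> are the signed permutation matrices of determinant \<open>1\<close>, that is the rotations of
  a cube; their axes pass through face centres, edge midpoints or vertices.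
\<close>

lemma fixed_axis_cases:
  assumes "A \<in> O_minus" "A \<noteq> mat 1" "rotpart A *v v3 x y z = v3 x y z"
  shows "y = 0 \<and> z = 0 \<or> x = 0 \<and> z = 0 \<or> x = 0 \<and> y = 0 \<or>
    z = 0 \<and> y = x \<or> z = 0 \<and> y = -x \<or> y = 0 \<and> z = x \<or> y = 0 \<and> z = -x \<or>
    x = 0 \<and> z = y \<or> x = 0 \<and> z = -y \<or>
    y = x \<and> z = x \<or> y = x \<and> z = -x \<or> y = -x \<and> z = x \<or> y = -x \<and> z = -x"
proof -
  \<comment> \<open>One equation per coordinate: as a single conjunction such as x = y, y = z, z = x they would loop as rewrite rules.\<close>
  have "(rotpart A *v v3 x y z) $ 1 = x" "(rotpart A *v v3 x y z) $ 2 = y"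
      "(rotpart A *v v3 x y z) $ 3 = z"
    using assms(3) by simp_all
  with assms(1,2) show ?thesis
    unfolding O_minus_elems by (elim insertE emptyE; simp add: m3_simps rotpart_def)
qed

lemma special_axis_cases:
  assumes "A \<in> O_minus" "A \<noteq> mat 1" "rotpart A *v a = a" "a \<noteq> 0"
  shows "conj_axis a (v3 0 0 1) \<or> conj_axis a (v3 1 (-1) 0) \<or> conj_axis a (v3 1 1 1)"
proof -
  obtain x y z where a: "a = v3 x y z" using v3_exhaust by blast
  have nz: "x \<noteq> 0 \<or> y \<noteq> 0 \<or> z \<noteq> 0" using assms(4) by (auto simp: a vec_eq_iff forall_3)
  have I: "conj_axis a b" if "t \<in> O_minus" "c \<noteq> 0" "t *v a = c *\<^sub>R b" for t c b
    using that unfolding conj_axis_def by blast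
  let ?P = "m3 0 0 1 1 0 0 0 1 0" and ?Q = "m3 0 1 0 0 0 1 1 0 0" and ?E = "m3 1 0 0 0 1 0 0 0 1"
    and ?F = "m3 1 0 0 0 (-1) 0 0 0 (-1)" and ?G = "m3 (-1) 0 0 0 1 0 0 0 (-1)"
    and ?H = "m3 (-1) 0 0 0 (-1) 0 0 0 1"
  have mem: "?E \<in> O_minus" "?P \<in> O_minus" "?Q \<in> O_minus" "?F \<in> O_minus" "?G \<in> O_minus" "?H \<in> O_minus"
    "m3 0 0 1 (-1) 0 0 0 (-1) 0 \<in> O_minus" "m3 0 1 0 0 0 (-1) (-1) 0 0 \<in> O_minus"
    unfolding O_minus_elems by auto
  from fixed_axis_cases[OF assms(1,2) assms(3)[unfolded a]] show ?thesis
  proof (elim disjE conjE, goal_cases)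
    case 1 then show ?thesis using I[OF mem(3), of x "v3 0 0 1"] nz by (simp add: a m3_simps)
  next
    case 2 then show ?thesis using I[OF mem(2), of y "v3 0 0 1"] nz by (simp add: a m3_simps)
  next
    case 3 then show ?thesis using I[OF mem(1), of z "v3 0 0 1"] nz by (simp add: a m3_simps)
  next
    case 4 then show ?thesis using I[OF mem(4), of x "v3 1 (-1) 0"] nz by (simp add: a m3_simps)
  next
    case 5 then show ?thesis using I[OF mem(1), of x "v3 1 (-1) 0"] nz by (simp add: a m3_simps)
  next
    case 6 then show ?thesis using I[OF mem(7), of x "v3 1 (-1) 0"] nz by (simp add: a m3_simps)
  next
    case 7 then show ?thesis using I[OF mem(2), of "-x" "v3 1 (-1) 0"] nz by (simp add: a m3_simps)
  next
    case 8 then show ?thesis using I[OF mem(8), of y "v3 1 (-1) 0"] nz by (simp add: a m3_simps)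
  next
    case 9 then show ?thesis using I[OF mem(3), of y "v3 1 (-1) 0"] nz by (simp add: a m3_simps)
  next
    case 10 then show ?thesis using I[OF mem(1), of x "v3 1 1 1"] nz by (simp add: a m3_simps)
  next
    case 11 then show ?thesis using I[OF mem(6), of "-x" "v3 1 1 1"] nz by (simp add: a m3_simps)
  next
    case 12 then show ?thesis using I[OF mem(5), of "-x" "v3 1 1 1"] nz by (simp add: a m3_simps)
  next
    case 13 then show ?thesis using I[OF mem(4), of x "v3 1 1 1"] nz by (simp add: a m3_simps)
  qed
qed

section \<open>Choosing the frame\<close>

lemma frame_exists:
  assumes "norm (a :: real^3) = 1" "norm b = 1" "a \<bullet> b = 0"
  obtains g where "orthogonal_matrix g" "g *v e3 = a" "g *v e1 = b"
proof -
  define M where "M = (vector [b, cross3 a b, a] :: real^3^3)"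
  have ab: "a \<bullet> a = 1" "b \<bullet> b = 1" "b \<bullet> a = 0" "a \<bullet> b = 0"
    using assms by (simp_all add: norm_eq_1 inner_commute)
  have "norm (cross3 a b) = 1"
    by (simp add: norm_eq_1 dot_cross ab)
  then have "orthogonal_matrix M"
    unfolding orthogonal_matrix_orthonormal_rows
    using assms ab by (simp add: M_def forall_3 row_def orthogonal_def dot_cross_self)
  then have "orthogonal_matrix (transpose M)"
    by (simp add: orthogonal_matrix_transpose)
  moreover have "transpose M *v e3 = a" "transpose M *v e1 = b"
    by (simp_all add: M_def matrix_vector_mult_basis column_transpose row_def vec_eq_iff 
        del: transpose_matrix_vector)
  ultimately show thesis using that by blast
qed

text \<open>
  Given a half turn \<open>rotpart A\<close> about \<open>b\<close>, the frame \<open>g\<close> has \<open>b\<close> as one of the secondary axes of the prism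
  group. In the frame \<open>h\<close>, turned by \<open>\<pi>/(2m)\<close>, the line of \<open>b\<close> lies halfway between two neighbouring
  secondary axes.
\<close>

lemma prism_realization:
  assumes "m > 0" "orthogonal_matrix A" "a \<noteq> 0" "b \<noteq> 0" "a \<bullet> b = 0"
    and "rotpart A *v a = - a" "rotpart A *v b = b"
  obtains g h c where "orthogonal_matrix g" "orthogonal_matrix h" "c \<noteq> 0"
    "g *v e3 = c *\<^sub>R a" "h *v e3 = c *\<^sub>R a" "A \<in> prism g m" "A \<notin> prism h m"
proof -
  define a' b' where "a' = a /\<^sub>R norm a" and "b' = b /\<^sub>R norm b"
  obtain g where g: "orthogonal_matrix g" "g *v e3 = a'" "g *v e1 = b'"
    by (rule frame_exists[of a' b']) (use assms in \<open>auto simp: a'_def b'_def\<close>)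
  define w where "w = cis (pi / (2 * real m))"
  define h where "h = g ** rotz (cnj w)"
  have w: "cmod w = 1" "w ^ (2 * m) = - 1"
    using assms(1) by (simp_all add: w_def Complex.DeMoivre del: power_mult)
  have rot: "rotpart A *v a' = - a'" "rotpart A *v b' = b'"
    using assms by (simp_all add: a'_def b'_def matrix_vector_mult_scaleR)
  have h: "orthogonal_matrix h" "h *v e3 = a'" 
    using g orthogonal_rotz[of "cnj w"] w(1) 
    by (auto simp: h_def orthogonal_matrix_mul rotz_e3 simp flip: matrix_vector_mul_assoc)
  have "rotz (cnj w) *v v3 (Re w) (Im w) 0 = e1"
    using w(1) complex_norm_square[of w] by (simp add: rotz_def m3_simps cmod_def power2_eq_square)
  then have hb: "h *v v3 (Re w) (Im w) 0 = b'"
    using g by (simp add: h_def flip: matrix_vector_mul_assoc)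
  have "A \<in> prism g m"
    using mem_prism_halfturn_iff[OF g(1) assms(2,1), of 1] g rot by (simp add: m3_simps(9))
  moreover have "A \<notin> prism h m"
    using mem_prism_halfturn_iff[OF h(1) assms(2,1) _ w(1)] h hb rot w(2) by simp
  ultimately show thesis
    using that[of g h "inverse (norm a)"] g h assms(3) by (simp add: a'_def)
qed

section \<open>Group structure of the intersections\<close>

lemma with_Z2c_subgroup:
  assumes "subgroup H O3"
  shows "subgroup (with_Z2c H) O3"
proof (rule O3.subgroupI)
  note H = subgroup.subset[OF assms] subgroup.m_closed[OF assms] subgroup.m_inv_closed[OF assms]
  have orth: "orthogonal_matrix A" if "A \<in> H" for A
    using that H(1) carrier_O3 by blast
  show "with_Z2c H \<subseteq> carrier O3"
    using orth orthogonal_uminus by (auto simp: with_Z2c_def)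
  show "with_Z2c H \<noteq> {}"
    using subgroup.one_closed[OF assms] by (auto simp: with_Z2c_def)
  have tr: "transpose (- A) = - transpose A" for A :: "real^3^3"
    by (simp add: transpose_def vec_eq_iff)
  have mm: "- A ** B = - (A ** B)" "A ** - B = - (A ** B)" for A B :: "real^3^3"
    by (simp_all add: vec_eq_iff matrix_matrix_mult_def sum_negf)
  fix A assume A: "A \<in> with_Z2c H"
  then show "inv\<^bsub>O3\<^esub> A \<in> with_Z2c H"
    using H(3) orth orthogonal_uminus by (fastforce simp: with_Z2c_def inv_O3 tr)
  fix B assume B: "B \<in> with_Z2c H"
  show "A \<otimes>\<^bsub>O3\<^esub> B \<in> with_Z2c H"
    using A B H(2) by (auto simp: with_Z2c_def mm)
qed

lemma conjugate_subgroup: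
  assumes "orthogonal_matrix g" "subgroup H O3"
  shows "subgroup (conjugate g H) O3"
proof (rule O3.subgroupI)
  have g: "g ** transpose g = mat 1" "transpose g ** g = mat 1"
    using assms(1) by (simp_all add: orthogonal_matrix_def)
  have sub: "conjugate g H \<subseteq> carrier O3"
    using assms subgroup.subset by (intro conjugate_carrier) auto
  then show "conjugate g H \<subseteq> carrier O3" .
  show "conjugate g H \<noteq> {}"
    using subgroup.one_closed[OF assms(2)] by (auto simp: conjugate_image)
  fix A B assume A: "A \<in> conjugate g H" and B: "B \<in> conjugate g H"
  have "transpose g ** (A ** B) ** g = (transpose g ** A ** g) ** (transpose g ** B ** g)"
    by (metis g(1) matrix_mul_assoc matrix_mul_rid)
  then show "A \<otimes>\<^bsub>O3\<^esub> B \<in> conjugate g H"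
    using A B subgroup.m_closed[OF assms(2)] by (simp add: mem_conjugate_iff[OF assms(1)])
  from A have orth: "orthogonal_matrix A" 
    using sub by auto
  have *: "orthogonal_matrix (transpose g ** A ** g)"
    using orth assms(1) by (simp add: orthogonal_matrix_mul orthogonal_matrix_transpose)
  have "transpose g ** transpose A ** g = inv\<^bsub>O3\<^esub> (transpose g ** A ** g)"
    by (simp add: inv_O3[OF *] matrix_transpose_mul matrix_mul_assoc)
  then show "inv\<^bsub>O3\<^esub> A \<in> conjugate g H"
    using A subgroup.m_inv_closed[OF assms(2)]
    by (simp add: mem_conjugate_iff[OF assms(1)] inv_O3[OF orth])
qed

lemma D_subgroup: "subgroup (D m) O3"
  unfolding D_def using orthogonal_matrix_rotation[of e3] orthogonal_matrix_rotation[of e1]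
  by (intro O3.generate_is_subgroup) auto

lemma prism_subgroup: "orthogonal_matrix g \<Longrightarrow> subgroup (prism g m) O3"
  unfolding prism_def by (intro conjugate_subgroup with_Z2c_subgroup D_subgroup)

lemma subgroup_mult_iff:
  assumes "subgroup H O3" "A \<in> H" "orthogonal_matrix B"
  shows "A ** B \<in> H \<longleftrightarrow> B \<in> H"
proof -
  have A: "orthogonal_matrix A" "transpose A \<in> H"
    using assms subgroup.subset[OF assms(1)] subgroup.m_inv_closed[OF assms(1,2)]
    by (auto simp: inv_O3 subset_iff)
  then have "transpose A ** (A ** B) = B"
    by (simp add: matrix_mul_assoc orthogonal_matrix_def)
  then show ?thesis
    using subgroup.m_closed[OF assms(1), unfolded mult_O3] assms(2) A(2) by metis
qed

definition clip :: "real^3^3 \<Rightarrow> nat \<Rightarrow> (real^3^3) set"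
  where "clip g m = O_minus \<inter> prism g m"

lemma clip_subgroup: "orthogonal_matrix g \<Longrightarrow> subgroup (clip g m) O3"
  unfolding clip_def using O3.subgroups_Inter_pair O_minus_subgroup prism_subgroup by blast

lemma clip_orthogonal: "A \<in> clip g m \<Longrightarrow> orthogonal_matrix A"
  using subgroup.subset[OF O_minus_subgroup] by (auto simp: clip_def)

text \<open>
  The group \<open>O_minus\<close> is invariant under conjugation by its own elements, so they can be used to normalise the
  position of the main axis.
\<close>

lemma clip_translate:
  assumes "t \<in> O_minus" "orthogonal_matrix g"
  shows "clip (t ** g) m = conjugate t (clip g m)"
    "conj_class (clip (t ** g) m) = conj_class (clip g m)"
proof -
  have t: "t \<in> carrier O3"
    using assms subgroup.subset[OF O_minus_subgroup] by blast
  have G: "with_Z2c (D m) \<subseteq> carrier O3" "O_minus \<subseteq> carrier O3"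
    using subgroup.subset with_Z2c_subgroup[OF D_subgroup] O_minus_subgroup by blast+
  have "conjugate t O_minus = O_minus"
  proof (intro equalityI subsetI)
    have tm: "transpose t \<in> O_minus"
      using subgroup.m_inv_closed[OF O_minus_subgroup assms(1)] t by (simp add: inv_O3)
    note cl = subgroup.m_closed[OF O_minus_subgroup, unfolded mult_O3]
    have t': "orthogonal_matrix t" using t by simp
    show "A \<in> O_minus" if "A \<in> conjugate t O_minus" for A
      using that cl assms(1) tm t' by (auto simp: conjugate_image inv_O3)
    show "A \<in> conjugate t O_minus" if "A \<in> O_minus" for A
      using that cl assms(1) tm by (simp add: mem_conjugate_iff[OF t'])
  qed
  moreover have "conjugate t (conjugate g (with_Z2c (D m))) = conjugate (t ** g) (with_Z2c (D m))"
    using conjugate_conjugate[of t g] t assms(2) G by simp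
  moreover have "conjugate g (with_Z2c (D m)) \<subseteq> carrier O3"
    using conjugate_carrier[of g] assms(2) G by simp
  ultimately show "clip (t ** g) m = conjugate t (clip g m)"
    unfolding clip_def prism_def using conjugate_Int[OF t] G by simp
  then show "conj_class (clip (t ** g) m) = conj_class (clip g m)"
    using t subgroup.subset[OF clip_subgroup[OF assms(2)]] by (simp add: conj_class_conjugate del: carrier_O3)
qed

lemma clip_eq_axis_stab:
  assumes "orthogonal_matrix g" "m > 0" "g *v e3 = c *\<^sub>R a" "c \<noteq> 0"
  shows "clip g m = {A \<in> axis_stab a. A \<in> prism g m}"
proof -
  have "rotpart A *v a = a \<or> rotpart A *v a = - a" if "A \<in> clip g m" for A
    using prism_axis[OF assms(1) clip_orthogonal[OF that] assms(2)] that assms(3,4)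
    by (auto simp: clip_def matrix_vector_mult_scaleR simp flip: scaleR_minus_right)
  then show ?thesis
    by (auto simp: axis_stab_def clip_def)
qed

section \<open>The groups of the classification as sets of matrices\<close>

lemma Z_2_eq: "Z 2 = {m3 1 0 0 0 1 0 0 0 1, m3 (-1) 0 0 0 (-1) 0 0 0 1}"
  and Z_1_eq: "Z 1 = {m3 1 0 0 0 1 0 0 0 1}"
proof -
  have "{z. z ^ 2 = (1::complex)} = {1, -1}" by (auto simp: power2_eq_1_iff)
  then show "Z 2 = {m3 1 0 0 0 1 0 0 0 1, m3 (-1) 0 0 0 (-1) 0 0 0 1}"
    by (simp add: Z_eq rotz_def)
  show "Z 1 = {m3 1 0 0 0 1 0 0 0 1}"
    unfolding Z_1 by (simp add: trivial_group_def m3_simps)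
qed

lemma D_2_eq: "D 2 = {m3 1 0 0 0 1 0 0 0 1, m3 (-1) 0 0 0 (-1) 0 0 0 1,
    m3 1 0 0 0 (-1) 0 0 0 (-1), m3 (-1) 0 0 0 1 0 0 0 (-1)}"
proof -
  have "{z. z ^ 2 = (1::complex)} = {1, -1}" by (auto simp: power2_eq_1_iff)
  then show ?thesis
    by (simp add: D_eq rotz_def flip_def m3_simps insert_commute)
qed

lemma Z2k_minus_1_eq: "Z2k_minus 1 = {m3 1 0 0 0 1 0 0 0 1, m3 1 0 0 0 1 0 0 0 (-1)}"
  unfolding Z2k_minus_def Z_1_eq rotation_e3
  by (simp add: l_coset_def rotz_def m3_simps insert_commute)

lemma Z2k_minus_2_eq: "Z2k_minus 2 = {m3 1 0 0 0 1 0 0 0 1, m3 (-1) 0 0 0 (-1) 0 0 0 1,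
    m3 0 1 0 (-1) 0 0 0 0 (-1), m3 0 (-1) 0 1 0 0 0 0 (-1)}"
  unfolding Z2k_minus_def Z_2_eq rotation_e3
  by (simp add: l_coset_def rotz_def m3_simps insert_commute)

lemma Dz_2_eq: "Dz 2 = {m3 1 0 0 0 1 0 0 0 1, m3 (-1) 0 0 0 (-1) 0 0 0 1,
    m3 (-1) 0 0 0 1 0 0 0 1, m3 1 0 0 0 (-1) 0 0 0 1}"
  unfolding Dz_def Z_2_eq rotation_e1_pi
  by (simp add: l_coset_def flip_def m3_simps insert_commute)

lemma D2k_d_2_eq: "D2k_d 2 = {m3 1 0 0 0 1 0 0 0 1, m3 (-1) 0 0 0 (-1) 0 0 0 1,
    m3 1 0 0 0 (-1) 0 0 0 (-1), m3 (-1) 0 0 0 1 0 0 0 (-1),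
    m3 0 1 0 (-1) 0 0 0 0 (-1), m3 0 (-1) 0 1 0 0 0 0 (-1), m3 0 (-1) 0 (-1) 0 0 0 0 1, m3 0 1 0 1 0 0 0 0 1}"
  unfolding D2k_d_def D_2_eq rotation_e3
  by (simp add: l_coset_def rotz_def m3_simps insert_commute)

lemma conj_class_eqI:
  assumes "orthogonal_matrix q" "K \<subseteq> {A. orthogonal_matrix A}" "(\<lambda>h. q ** h ** transpose q) ` K = L"
  shows "conj_class L = conj_class K"
  using conj_class_conjugate[of q K] assms by (auto simp: conjugate_image inv_O3 subset_iff)

text \<open>
  An eighth of a turn about \<open>e\<^sub>3\<close> moves the mirrors of \<open>Dz 2\<close>, which are coordinate planes, to the two diagonal ones.
\<close>

lemma conj_class_Dz_2:
  "conj_class {m3 1 0 0 0 1 0 0 0 1, m3 (-1) 0 0 0 (-1) 0 0 0 1,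
    m3 0 (-1) 0 (-1) 0 0 0 0 1, m3 0 1 0 1 0 0 0 0 1} = conj_class (Dz 2)"
proof -
  \<comment> \<open>the cosine and the sine of \<open>\<pi>/4\<close>\<close>
  define w :: real where "w = 1 / sqrt 2"
  have w: "w * w = 1 / 2" "w * w + w * w = 1" by (simp_all add: w_def)
  define q where "q = m3 w (-w) 0 w w 0 0 0 1"
  show ?thesis
  proof (rule conj_class_eqI)
    show "orthogonal_matrix q"
      by (simp add: q_def orthogonal_matrix_def m3_simps w)
    show "Dz 2 \<subseteq> {A. orthogonal_matrix A}"
      by (auto simp: Dz_2_eq orthogonal_matrix_def m3_simps)
    show "(\<lambda>h. q ** h ** transpose q) ` Dz 2 = {m3 1 0 0 0 1 0 0 0 1, m3 (-1) 0 0 0 (-1) 0 0 0 1,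
      m3 0 (-1) 0 (-1) 0 0 0 0 1, m3 0 1 0 1 0 0 0 0 1}"
      by (simp add: Dz_2_eq q_def m3_simps w insert_commute)
  qed
qed

lemma cube_roots_of_unity:
  "{z. z ^ 3 = (1::complex)} = {1, Complex (-1/2) (sqrt 3/2), Complex (-1/2) (-sqrt 3/2)}"
proof -
  let ?w = "Complex (-1/2) (sqrt 3/2)" and ?w' = "Complex (-1/2) (-sqrt 3/2)"
  have 1: "?w + ?w' = -1" "?w * ?w' = 1" by (simp_all add: complex_eq_iff)
  have "z ^ 3 - 1 = (z - 1) * (z - ?w) * (z - ?w')" for z
    using 1 by algebra
  then have "z ^ 3 = 1 \<longleftrightarrow> z = 1 \<or> z = ?w \<or> z = ?w'" for z
    by (metis eq_iff_diff_eq_0 mult_eq_0_iff)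
  then show ?thesis by auto
qed

text \<open>
  Both identities come from the same change of basis, which sends \<open>e\<^sub>3\<close> to the direction of \<open>(1,1,1)\<close> and
  \<open>e\<^sub>1\<close> to that of \<open>(1,-1,0)\<close>, so that \<open>- flip\<close> becomes the exchange of the first two coordinates.
\<close>

lemma conj_class_Z_3:
  "conj_class {m3 1 0 0 0 1 0 0 0 1, m3 0 1 0 0 0 1 1 0 0, m3 0 0 1 1 0 0 0 1 0} = conj_class (Z 3)"
  "conj_class {m3 1 0 0 0 1 0 0 0 1, m3 0 1 0 0 0 1 1 0 0, m3 0 0 1 1 0 0 0 1 0,
     m3 0 1 0 1 0 0 0 0 1, m3 1 0 0 0 0 1 0 1 0, m3 0 0 1 0 1 0 1 0 0} = conj_class (Dz 3)"
proof -
  define x y z s :: real where "x = 1 / sqrt 2" and "y = 1 / sqrt 6" and "z = 1 / sqrt 3" and "s = sqrt 3 / 2"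
  have eqs: "x * x = 1/2" "y * y = 1/6" "z * z = 1/3"
    by (simp_all add: x_def y_def z_def)
  have xys: "x * y * s = 1/4"
    using real_sqrt_mult[of 2 3] by (simp add: x_def y_def s_def)
  then have num: "y * (y * r) = r/6" "s * (x * (y * r)) = r/4" for r
    using eqs by algebra+
  define q where "q = m3 x y z (-x) y z 0 (-2*y) z"
  have q: "orthogonal_matrix q"
    using eqs by (simp add: q_def orthogonal_matrix_def m3_simps)
  have Z3: "Z 3 = {mat 1, m3 (-1/2) (-s) 0 s (-1/2) 0 0 0 1, m3 (-1/2) s 0 (-s) (-1/2) 0 0 0 1}"
    using cube_roots_of_unity by (simp add: Z_eq rotz_def m3_simps s_def)
  let ?c = "\<lambda>h. q ** h ** transpose q"
  have c: "?c (mat 1) = mat 1" "?c (m3 (-1/2) (-s) 0 s (-1/2) 0 0 0 1) = m3 0 0 1 1 0 0 0 1 0"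
    "?c (m3 (-1/2) s 0 (-s) (-1/2) 0 0 0 1) = m3 0 1 0 0 0 1 1 0 0"
    "?c (- flip) = m3 0 1 0 1 0 0 0 0 1"
    by (simp_all add: q_def flip_def m3_simps algebra_simps eqs num)
  have c_mult: "?c (A ** B) = ?c A ** ?c B" for A B
  proof -
    have "?c A ** ?c B = q ** A ** (transpose q ** q) ** B ** transpose q"
      by (simp only: matrix_mul_assoc)
    also have "transpose q ** q = mat 1"
      using q by (simp add: orthogonal_matrix_def)
    finally show ?thesis
      by (simp add: matrix_mul_assoc)
  qed
  show "conj_class {m3 1 0 0 0 1 0 0 0 1, m3 0 1 0 0 0 1 1 0 0, m3 0 0 1 1 0 0 0 1 0} = conj_class (Z 3)"
  proof (rule conj_class_eqI[OF q])
    show "Z 3 \<subseteq> {A. orthogonal_matrix A}"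
      unfolding Z_def using orthogonal_matrix_rotation[of e3] by auto
    show "?c ` Z 3 = {m3 1 0 0 0 1 0 0 0 1, m3 0 1 0 0 0 1 1 0 0, m3 0 0 1 1 0 0 0 1 0}"
      unfolding Z3 image_insert c image_empty by (simp add: m3_simps insert_commute)
  qed
  show "conj_class {m3 1 0 0 0 1 0 0 0 1, m3 0 1 0 0 0 1 1 0 0, m3 0 0 1 1 0 0 0 1 0,
     m3 0 1 0 1 0 0 0 0 1, m3 1 0 0 0 0 1 0 1 0, m3 0 0 1 0 1 0 1 0 0} = conj_class (Dz 3)"
  proof (rule conj_class_eqI[OF q])
    have Dz3: "Dz 3 = Z 3 \<union> (\<lambda>h. - flip ** h) ` Z 3"
      unfolding Dz_def rotation_e1_pi l_coset_def by auto
    show "Dz 3 \<subseteq> {A. orthogonal_matrix A}"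
      unfolding Dz3 Z_def using orthogonal_matrix_rotation[of e3] 
      by (auto intro!: orthogonal_matrix_mul orthogonal_uminus orthogonal_flip)
    show "?c ` Dz 3 = {m3 1 0 0 0 1 0 0 0 1, m3 0 1 0 0 0 1 1 0 0, m3 0 0 1 1 0 0 0 1 0,
     m3 0 1 0 1 0 0 0 0 1, m3 1 0 0 0 0 1 0 1 0, m3 0 0 1 0 1 0 1 0 0}"
      unfolding Dz3 image_Un image_image c_mult unfolding Z3 image_insert c image_empty 
      by (simp add: m3_simps insert_commute)
  qed
qed

section \<open>Intersections without rotational part\<close>

text \<open>
  The rotation \<open>rotpart A\<close> is again an involution, and not the identity. If \<open>x\<close> is not reversed by it,
  then the sum of \<open>x\<close> and its image spans the axis; a frame with \<open>e\<^sub>3\<close> on that axis makes the rotation equal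
  to \<open>rotz (- 1)\<close>.
\<close>

lemma involution_class:
  assumes "orthogonal_matrix A" "A ** A = mat 1" "A \<noteq> mat 1" "A \<noteq> - mat 1"
  shows "conj_class {mat 1, A} = conj_class (if det A = 1 then Z 2 else Z2k_minus 1)"
proof -
  let ?H = "m3 (-1) 0 0 0 (-1) 0 0 0 1"
  define R where "R = rotpart A"
  note R = rotpart_props[OF assms(1), folded R_def]
  have RR: "R ** R = mat 1" 
    using assms(2) by (cases rule: rotpart_cases[OF assms(1)]) 
      (simp_all add: R_def vec_eq_iff matrix_matrix_mult_def sum_negf)
  have R1: "R \<noteq> mat 1"
    using assms(3,4) by (cases rule: rotpart_cases[OF assms(1)]) (simp_all add: R_def, metis add.inverse_inverse)
  have "R \<noteq> - mat 1"
    using R(2) by (auto simp: det_uminus_3)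
  moreover have "(- mat 1) *v x = - x" for x :: "real^3"
    using scaleR_matrix_vector_assoc[of "- 1" "mat 1" x] by simp
  ultimately obtain x where x: "R *v x \<noteq> - x"
    by (metis matrix_eq)
  define u where "u = R *v x + x"
  have u: "u \<noteq> 0" "R *v u = u"
    using x RR by (auto simp: u_def add_eq_0_iff matrix_vector_right_distrib matrix_vector_mul_assoc add.commute)
  define a where "a = u /\<^sub>R norm u"
  obtain b where b: "b \<noteq> 0" "orthogonal a b"
    using orthogonal_to_vector_exists[of a] by auto
  obtain g where g: "orthogonal_matrix g" "g *v e3 = a"
    by (rule frame_exists[of a "b /\<^sub>R norm b"]) (use u b in \<open>auto simp: a_def orthogonal_def\<close>)
  have "R *v (g *v e3) = g *v e3"
    using u by (simp add: g a_def matrix_vector_mult_scaleR)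
  then obtain z where z: "cmod z = 1" "transpose g ** R ** g = rotz z"
    using conj_rotation[OF g(1) R] by (metis axis_rotation_eq_rotz conj_matrix_vec_iff[OF g(1)])
  have gg: "g ** transpose g = mat 1" using g(1) by (simp add: orthogonal_matrix_def)
  have unconj: "g ** (transpose g ** B ** g) ** transpose g = B" for B
    by (metis gg matrix_mul_assoc matrix_mul_lid matrix_mul_rid)
  have "rotz z ** rotz z = transpose g ** (R ** R) ** g"
    unfolding z(2)[symmetric] by (metis gg matrix_mul_assoc matrix_mul_rid)
  then have "rotz (z * z) = rotz 1"
    using g(1) by (simp add: RR rotz_mult orthogonal_matrix_def rotz_1)
  moreover have "z \<noteq> 1"
    using unconj[of R] R1 gg by (auto simp: z rotz_1)
  ultimately have "z = - 1"
    by (metis power2_eq_1_iff power2_eq_square rotz_eq_iff(1))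
  then have R': "g ** ?H ** transpose g = R"
    using unconj[of R] by (simp add: z) (simp add: rotz_def)
  have lin: "g ** (- B) ** transpose g = - (g ** B ** transpose g)" for B
    by (simp add: vec_eq_iff matrix_matrix_mult_def sum_negf)
  have one: "m3 1 0 0 0 1 0 0 0 1 = mat 1" by (simp add: m3_simps)
  show ?thesis
  proof (cases rule: rotpart_cases[OF assms(1)])
    case 1
    have "conj_class {mat 1, A} = conj_class (Z 2)"
    proof (rule conj_class_eqI[OF g(1)])
      show "Z 2 \<subseteq> {A. orthogonal_matrix A}"
        by (auto simp: Z_2_eq orthogonal_matrix_def m3_simps)
      show "(\<lambda>h. g ** h ** transpose g) ` Z 2 = {mat 1, A}"
        unfolding Z_2_eq one image_insert R' using 1 gg by (simp add: R_def)
    qed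
    with 1 show ?thesis by simp
  next
    case 2
    have H: "m3 1 0 0 0 1 0 0 0 (-1) = - ?H" by (simp add: m3_simps)
    have "A = - R" using 2 by (simp add: R_def)
    have "conj_class {mat 1, A} = conj_class (Z2k_minus 1)"
    proof (rule conj_class_eqI[OF g(1)])
      show "Z2k_minus 1 \<subseteq> {A. orthogonal_matrix A}"
        unfolding Z2k_minus_1_eq by (auto simp: orthogonal_matrix_def m3_simps)
      show "(\<lambda>h. g ** h ** transpose g) ` Z2k_minus 1 = {mat 1, A}"
        unfolding Z2k_minus_1_eq H one image_insert lin R' \<open>A = - R\<close> using gg by simp
    qed
    with 2 show ?thesis by simp
  qed
qed

text \<open>
  Every nontrivial element reverses the main axis by its rotational part, so a product of two of them fixes it
  and is therefore trivial. Consequently any two nontrivial elements are inverse to each other, in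
  particular each to itself, and there is at most one.
\<close>

lemma small_clip_class:
  assumes g: "orthogonal_matrix g" and "m > 0"
    and triv: "\<And>A. A \<in> clip g m \<Longrightarrow> rotpart A *v (g *v e3) = g *v e3 \<Longrightarrow> A = mat 1"
  shows "conj_class (clip g m) \<in> {conj_class trivial_group, conj_class (Z 2), conj_class (Z2k_minus 1)}"
proof -
  note sub = clip_subgroup[OF g, of m]
  have one: "mat 1 \<in> clip g m" 
    using subgroup.one_closed[OF sub] by simp
  have prod: "A ** B = mat 1" if "A \<in> clip g m" "B \<in> clip g m" "A \<noteq> mat 1" "B \<noteq> mat 1" for A B
  proof -
    have rev: "rotpart C *v (g *v e3) = - (g *v e3)" if "C \<in> clip g m" "C \<noteq> mat 1" for C
      using prism_axis[OF g clip_orthogonal[OF that(1)] assms(2)] triv[OF that(1)] that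
      by (auto simp: clip_def)
    have "rotpart (A ** B) = rotpart A ** rotpart B"
      by (simp add: rotpart_def det_mul matrix_scalar_ac mult.commute flip: scalar_matrix_assoc)
    then have "rotpart (A ** B) *v (g *v e3) = rotpart A *v (rotpart B *v (g *v e3))"
      by (simp add: matrix_vector_mul_assoc matrix_mul_assoc)
    also have "\<dots> = g *v e3"
      using rev that by (simp add: linear_neg)
    finally show ?thesis
      using triv subgroup.m_closed[OF sub, of A B] that by simp
  qed
  show ?thesis
  proof (cases "clip g m = {mat 1}")
    case True
    then show ?thesis by (simp add: trivial_group_def)
  next
    case False
    then obtain A where A: "A \<in> clip g m" "A \<noteq> mat 1" using one by blast
    have "B = A" if "B \<in> clip g m" "B \<noteq> mat 1" for B
      using prod[OF A(1) that(1) A(2) that(2)] prod[OF A(1) A(1) A(2) A(2)]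
      by (metis matrix_mul_assoc matrix_mul_lid matrix_mul_rid)
    then have "clip g m = {mat 1, A}" using A one by blast
    moreover have "- mat 1 \<notin> O_minus"
      unfolding O_minus_elems by (simp add: m3_simps)
    then have "A \<noteq> - mat 1" using A by (auto simp: clip_def)
    ultimately show ?thesis
      using involution_class[OF clip_orthogonal[OF A(1)]] prod[OF A(1) A(1) A(2) A(2)] A(2) by simp
  qed
qed

section \<open>Intersections with a symmetry axis in common\<close>

lemma power_eq_1_iff_dvd:
  fixes z :: complex
  assumes "z ^ k = 1" "k > 0" "\<And>j. 0 < j \<Longrightarrow> j < k \<Longrightarrow> z ^ j \<noteq> 1"
  shows "z ^ m = 1 \<longleftrightarrow> k dvd m"
proof -
  have "z ^ m = z ^ (k * (m div k) + m mod k)" by simp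
  also have "\<dots> = z ^ (m mod k)" by (simp only: power_add power_mult assms(1)) simp
  finally show ?thesis
    using assms(2) assms(3)[of "m mod k"] by (auto simp: dvd_eq_mod_eq_0)
qed

lemma axis_rotation_in_prism_iff:
  assumes g: "orthogonal_matrix g" "m > 0" "g *v e3 = c *\<^sub>R a"
    and A: "A \<in> O_minus" "rotpart A *v a = a"
  shows "trace (rotpart A) = - 1 \<Longrightarrow> A \<in> prism g m \<longleftrightarrow> 2 dvd m"
    and "trace (rotpart A) = 0 \<Longrightarrow> A \<in> prism g m \<longleftrightarrow> 3 dvd m"
    and "trace (rotpart A) = 1 \<Longrightarrow> A \<in> prism g m \<longleftrightarrow> 4 dvd m"
proof -
  have orth: "orthogonal_matrix A"
    using A(1) subgroup.subset[OF O_minus_subgroup] by auto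
  have rot: "rotpart A *v (g *v e3) = g *v e3"
    using g(3) A(2) by (simp add: matrix_vector_mult_scaleR)
  note iff = mem_prism_rotation_iff[OF g(1) orth g(2) rot]
  have "(-1::complex) ^ m = 1 \<longleftrightarrow> 2 dvd m"
    by (rule power_eq_1_iff_dvd) (auto simp: less_Suc_eq numeral_2_eq_2)
  then show "trace (rotpart A) = - 1 \<Longrightarrow> A \<in> prism g m \<longleftrightarrow> 2 dvd m"
    using iff[of "- 1"] by simp
  have "\<i> ^ m = 1 \<longleftrightarrow> 4 dvd m"
    by (rule power_eq_1_iff_dvd) (auto simp: less_Suc_eq numeral_eq_Suc complex_eq_iff)
  then show "trace (rotpart A) = 1 \<Longrightarrow> A \<in> prism g m \<longleftrightarrow> 4 dvd m"
    using iff[of \<i>] by simp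
  let ?w = "Complex (-1/2) (sqrt 3/2)"
  have "?w ^ 3 = 1"
    using cube_roots_of_unity by auto
  then have "?w ^ m = 1 \<longleftrightarrow> 3 dvd m"
    by (rule power_eq_1_iff_dvd) (auto simp: less_Suc_eq numeral_eq_Suc complex_eq_iff)
  then show "trace (rotpart A) = 0 \<Longrightarrow> A \<in> prism g m \<longleftrightarrow> 3 dvd m"
    using iff[of ?w] by (simp add: cmod_def power2_eq_square)
qed

lemma O_minus_prod_in_prism_iff:
  assumes "orthogonal_matrix g" "A \<in> prism g m" "B \<in> O_minus"
  shows "A ** B \<in> prism g m \<longleftrightarrow> B \<in> prism g m"
  using subgroup_mult_iff[OF prism_subgroup[OF assms(1)] assms(2)] assms(3)
    subgroup.subset[OF O_minus_subgroup] by auto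

lemma one_in_prism: "orthogonal_matrix g \<Longrightarrow> m3 1 0 0 0 1 0 0 0 1 \<in> prism g m"
  using subgroup.one_closed[OF prism_subgroup] by (simp add: m3_simps)

text \<open>
  Products with the half turn \<open>H\<close> about \<open>e\<^sub>3\<close> pair the half turn \<open>F\<close> with \<open>F'\<close> and the reflection \<open>R\<close> with
  \<open>R'\<close>; the rotoreflection \<open>S\<close> relates the two pairs by \<open>S R = F\<close> and \<open>F R = S\<close>. If \<open>S\<close> is present, it makes
  the pairs equivalent; if not, they exclude each other. For odd \<open>m\<close> neither \<open>H\<close> nor \<open>S\<close> is present, which
  is the situation of \<open>small_clip_class\<close>.
\<close>

lemma fourfold_axis_clip:
  assumes g: "orthogonal_matrix g" "m > 0" "g *v e3 = c *\<^sub>R v3 0 0 1" "c \<noteq> 0"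
  shows "4 dvd m \<Longrightarrow> clip g m = (if flip \<in> prism g m then D2k_d 2 else Z2k_minus 2)"
    and "2 dvd m \<Longrightarrow> \<not> 4 dvd m \<Longrightarrow> clip g m =
      (if flip \<in> prism g m then D 2
       else if m3 0 1 0 1 0 0 0 0 1 \<in> prism g m
         then {m3 1 0 0 0 1 0 0 0 1, m3 (-1) 0 0 0 (-1) 0 0 0 1,
           m3 0 (-1) 0 (-1) 0 0 0 0 1, m3 0 1 0 1 0 0 0 0 1}
       else Z 2)"
    and "\<not> 2 dvd m \<Longrightarrow> A \<in> clip g m \<Longrightarrow> rotpart A *v (g *v e3) = g *v e3 \<Longrightarrow> A = mat 1"
proof -
  let ?H = "m3 (-1) 0 0 0 (-1) 0 0 0 1" and ?F = "m3 1 0 0 0 (-1) 0 0 0 (-1)"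
    and ?F' = "m3 (-1) 0 0 0 1 0 0 0 (-1)" and ?R = "m3 0 1 0 1 0 0 0 0 1" and ?R' = "m3 0 (-1) 0 (-1) 0 0 0 0 1"
    and ?S = "m3 0 1 0 (-1) 0 0 0 0 (-1)" and ?S' = "m3 0 (-1) 0 1 0 0 0 0 (-1)"
  have mem: "?H \<in> O_minus" "?S \<in> O_minus" "?S' \<in> O_minus" "?F \<in> O_minus" "?R \<in> O_minus"
    unfolding O_minus_elems by blast+
  note rot = axis_rotation_in_prism_iff[OF g(1-3)]
  have H: "?H \<in> prism g m \<longleftrightarrow> 2 dvd m"
    by (rule rot(1)[OF mem(1)]) (simp_all add: rotpart_def m3_simps)
  have S: "?S \<in> prism g m \<longleftrightarrow> 4 dvd m"
    by (rule rot(3)[OF mem(2)]) (simp_all add: rotpart_def m3_simps)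
  have S': "?S' \<in> prism g m \<longleftrightarrow> 4 dvd m"
    by (rule rot(3)[OF mem(3)]) (simp_all add: rotpart_def m3_simps)
  note prod = O_minus_prod_in_prism_iff[OF g(1)]
  have HF: "?F' \<in> prism g m \<longleftrightarrow> ?F \<in> prism g m" "?R' \<in> prism g m \<longleftrightarrow> ?R \<in> prism g m" if "2 dvd m"
    using prod[OF H[THEN iffD2, OF that] mem(4)] prod[OF H[THEN iffD2, OF that] mem(5)] by (simp_all add: m3_simps)
  have SR: "?F \<in> prism g m \<longleftrightarrow> ?R \<in> prism g m" if "4 dvd m"
    using prod[OF S[THEN iffD2, OF that] mem(5)] by (simp add: m3_simps)
  have FR: "?S \<in> prism g m \<longleftrightarrow> ?R \<in> prism g m" if "?F \<in> prism g m"
    using prod[OF that mem(5)] by (simp add: m3_simps)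
  note clip = clip_eq_axis_stab[OF g, unfolded axis_stab_eq filter_insert_set]
  note one = one_in_prism[OF g(1)]
  show "clip g m = (if flip \<in> prism g m then D2k_d 2 else Z2k_minus 2)" if "4 dvd m"
  proof -
    have "2 dvd m" using that by (rule dvd_trans[rotated]) simp
    then show ?thesis
      unfolding clip D2k_d_2_eq Z2k_minus_2_eq flip_def
      using that by (simp add: H S S' HF one insert_commute flip: SR)
  qed
  show "clip g m = (if flip \<in> prism g m then D 2 else if ?R \<in> prism g m
      then {m3 1 0 0 0 1 0 0 0 1, ?H, ?R', ?R} else Z 2)" if "2 dvd m" "\<not> 4 dvd m"
    unfolding clip D_2_eq Z_2_eq flip_def
    using that FR by (auto simp: H S S' HF one)
  show "A = mat 1" if "\<not> 2 dvd m" "A \<in> clip g m" "rotpart A *v (g *v e3) = g *v e3"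
  proof -
    have "\<not> 4 dvd m" using that(1) dvd_trans[of 2 4 m] by auto
    moreover have "rotpart A *v v3 0 0 1 = v3 0 0 1"
      using that(3) g by (simp add: matrix_vector_mult_scaleR)
    moreover have "A \<in> prism g m" "A \<in> axis_stab (v3 0 0 1)"
      using that(2) clip_eq_axis_stab[OF g] by auto
    ultimately show ?thesis
      using that(1) H S S' unfolding axis_stab_eq
      by (elim insertE emptyE) (simp_all add: rotpart_def m3_simps)
  qed
qed

text \<open>
  The vector \<open>(1,-1,0)\<close> is the normal of the reflection \<open>R\<close>, which is present exactly for even \<open>m\<close>. Then \<open>R\<close>
  ties the half turn \<open>H\<close> to the second reflection \<open>R'\<close>.
\<close>

lemma twofold_axis_clip:
  assumes g: "orthogonal_matrix g" "m > 0" "g *v e3 = c *\<^sub>R v3 1 (-1) 0" "c \<noteq> 0"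
  shows "2 dvd m \<Longrightarrow> clip g m =
      (if m3 (-1) 0 0 0 (-1) 0 0 0 1 \<in> prism g m
         then {m3 1 0 0 0 1 0 0 0 1, m3 (-1) 0 0 0 (-1) 0 0 0 1,
           m3 0 (-1) 0 (-1) 0 0 0 0 1, m3 0 1 0 1 0 0 0 0 1}
       else {m3 1 0 0 0 1 0 0 0 1, m3 0 1 0 1 0 0 0 0 1})"
    and "\<not> 2 dvd m \<Longrightarrow> A \<in> clip g m \<Longrightarrow> rotpart A *v (g *v e3) = g *v e3 \<Longrightarrow> A = mat 1"
proof -
  let ?H = "m3 (-1) 0 0 0 (-1) 0 0 0 1" and ?R = "m3 0 1 0 1 0 0 0 0 1" and ?R' = "m3 0 (-1) 0 (-1) 0 0 0 0 1"
  have mem: "?H \<in> O_minus" "?R \<in> O_minus"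
    unfolding O_minus_elems by blast+
  have R: "?R \<in> prism g m \<longleftrightarrow> 2 dvd m"
    by (rule axis_rotation_in_prism_iff(1)[OF g(1-3) mem(2)]) (simp_all add: rotpart_def m3_simps)
  have RH: "?R' \<in> prism g m \<longleftrightarrow> ?H \<in> prism g m" if "2 dvd m"
    using O_minus_prod_in_prism_iff[OF g(1) R[THEN iffD2, OF that] mem(1)] by (simp add: m3_simps)
  note clip = clip_eq_axis_stab[OF g, unfolded axis_stab_eq filter_insert_set]
  note one = one_in_prism[OF g(1)]
  show "clip g m = (if ?H \<in> prism g m then {m3 1 0 0 0 1 0 0 0 1, ?H, ?R', ?R}
      else {m3 1 0 0 0 1 0 0 0 1, ?R})" if "2 dvd m"
    unfolding clip using that by (simp add: R RH one insert_commute)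
  show "A = mat 1" if "\<not> 2 dvd m" "A \<in> clip g m" "rotpart A *v (g *v e3) = g *v e3"
  proof -
    have "rotpart A *v v3 1 (-1) 0 = v3 1 (-1) 0"
      using that(3) g by (simp add: matrix_vector_mult_scaleR)
    moreover have "A \<in> prism g m" "A \<in> axis_stab (v3 1 (-1) 0)"
      using that(2) clip_eq_axis_stab[OF g] by auto
    ultimately show ?thesis
      using that(1) R unfolding axis_stab_eq
      by (elim insertE emptyE) (simp_all add: rotpart_def m3_simps)
  qed
qed

text \<open>
  The three reflections that preserve the diagonal differ by the rotations \<open>P\<close> and \<open>Q\<close> of order three, which
  are present exactly if \<open>3 | m\<close>.
\<close>

lemma threefold_axis_clip:
  assumes g: "orthogonal_matrix g" "m > 0" "g *v e3 = c *\<^sub>R v3 1 1 1" "c \<noteq> 0"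
  shows "3 dvd m \<Longrightarrow> clip g m =
      (if m3 0 1 0 1 0 0 0 0 1 \<in> prism g m
         then {m3 1 0 0 0 1 0 0 0 1, m3 0 1 0 0 0 1 1 0 0, m3 0 0 1 1 0 0 0 1 0,
           m3 0 1 0 1 0 0 0 0 1, m3 1 0 0 0 0 1 0 1 0, m3 0 0 1 0 1 0 1 0 0}
       else {m3 1 0 0 0 1 0 0 0 1, m3 0 1 0 0 0 1 1 0 0, m3 0 0 1 1 0 0 0 1 0})"
    and "\<not> 3 dvd m \<Longrightarrow> A \<in> clip g m \<Longrightarrow> rotpart A *v (g *v e3) = g *v e3 \<Longrightarrow> A = mat 1"
proof -
  let ?Q = "m3 0 1 0 0 0 1 1 0 0" and ?P = "m3 0 0 1 1 0 0 0 1 0" and ?R = "m3 0 1 0 1 0 0 0 0 1"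
    and ?R1 = "m3 1 0 0 0 0 1 0 1 0" and ?R2 = "m3 0 0 1 0 1 0 1 0 0"
  have mem: "?Q \<in> O_minus" "?P \<in> O_minus" "?R \<in> O_minus"
    unfolding O_minus_elems by blast+
  have Q: "?Q \<in> prism g m \<longleftrightarrow> 3 dvd m"
    by (rule axis_rotation_in_prism_iff(2)[OF g(1-3) mem(1)]) (simp_all add: rotpart_def m3_simps)
  have P: "?P \<in> prism g m \<longleftrightarrow> 3 dvd m"
    by (rule axis_rotation_in_prism_iff(2)[OF g(1-3) mem(2)]) (simp_all add: rotpart_def m3_simps)
  have R12: "?R1 \<in> prism g m \<longleftrightarrow> ?R \<in> prism g m" "?R2 \<in> prism g m \<longleftrightarrow> ?R \<in> prism g m" if "3 dvd m"
    using O_minus_prod_in_prism_iff[OF g(1) Q[THEN iffD2, OF that] mem(3)] 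
       O_minus_prod_in_prism_iff[OF g(1) P[THEN iffD2, OF that] mem(3)] by (simp_all add: m3_simps)
  note clip = clip_eq_axis_stab[OF g, unfolded axis_stab_eq filter_insert_set]
  note one = one_in_prism[OF g(1)]
  show "clip g m = (if ?R \<in> prism g m then {m3 1 0 0 0 1 0 0 0 1, ?Q, ?P, ?R, ?R1, ?R2}
      else {m3 1 0 0 0 1 0 0 0 1, ?Q, ?P})" if "3 dvd m"
    unfolding clip using that by (simp add: Q P R12 one insert_commute)
  show "A = mat 1" if "\<not> 3 dvd m" "A \<in> clip g m" "rotpart A *v (g *v e3) = g *v e3"
  proof -
    have "rotpart A *v v3 1 1 1 = v3 1 1 1"
      using that(3) g by (simp add: matrix_vector_mult_scaleR)
    moreover have "A \<in> prism g m" "A \<in> axis_stab (v3 1 1 1)"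
      using that(2) clip_eq_axis_stab[OF g] by auto
    ultimately show ?thesis
      using that(1) Q P unfolding axis_stab_eq
      by (elim insertE emptyE) (simp_all add: rotpart_def m3_simps)
  qed
qed

section \<open>The clips table\<close>

lemma reflection_class:
  "conj_class {m3 1 0 0 0 1 0 0 0 1, m3 0 1 0 1 0 0 0 0 1} = conj_class (Z2k_minus 1)"
proof -
  have "m3 1 0 0 0 1 0 0 0 1 = mat 1" by (simp add: m3_simps)
  then show ?thesis
    using involution_class[of "m3 0 1 0 1 0 0 0 0 1"] by (simp add: m3_simps orthogonal_matrix_def)
qed

text \<open>
  The three cases of the classification merged into one condition on the divisors of \<open>m\<close>. The groups
  \<open>\<int>\<^sub>1\<close> and \<open>\<D>\<^sub>1\<^sup>z\<close> give nothing beyond the first line.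
\<close>

definition listed_class :: "nat \<Rightarrow> (real^3^3) set set \<Rightarrow> bool"
  where "listed_class m C \<longleftrightarrow>
    C \<in> {conj_class trivial_group, conj_class (Z 2), conj_class (Z2k_minus 1)} \<or>
    3 dvd m \<and> C \<in> {conj_class (Z 3), conj_class (Dz 3)} \<or>
    2 dvd m \<and> C = conj_class (Dz 2) \<or>
    2 dvd m \<and> \<not> 4 dvd m \<and> C = conj_class (D 2) \<or>
    4 dvd m \<and> C \<in> {conj_class (Z2k_minus 2), conj_class (D2k_d 2)}"

lemma special_axis_clip_listed:
  assumes g: "orthogonal_matrix g" "m > 0" "g *v e3 = c *\<^sub>R a" "c \<noteq> 0"
    and a: "a = v3 0 0 1 \<or> a = v3 1 (-1) 0 \<or> a = v3 1 1 1"
  shows "listed_class m (conj_class (clip g m))"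
proof (cases "\<exists>A\<in>clip g m. A \<noteq> mat 1 \<and> rotpart A *v (g *v e3) = g *v e3")
  case False
  then have "conj_class (clip g m) \<in> {conj_class trivial_group, conj_class (Z 2), conj_class (Z2k_minus 1)}"
    by (intro small_clip_class[OF g(1,2)]) blast
  then show ?thesis by (simp add: listed_class_def)
next
  case True
  then obtain A where A: "A \<in> clip g m" "A \<noteq> mat 1" "rotpart A *v (g *v e3) = g *v e3" by blast
  from a show ?thesis
  proof (elim disjE)
    assume a: "a = v3 0 0 1"
    note clip = fourfold_axis_clip[OF g[unfolded a]]
    have "2 dvd m" using clip(3) A by blast
    then show ?thesis
      using clip(1,2) conj_class_Dz_2 by (cases "4 dvd m") (simp_all add: listed_class_def)
  next
    assume a: "a = v3 1 (-1) 0"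
    note clip = twofold_axis_clip[OF g[unfolded a]]
    have "2 dvd m" using clip(2) A by blast
    then show ?thesis
      using clip(1) conj_class_Dz_2 reflection_class by (simp add: listed_class_def)
  next
    assume a: "a = v3 1 1 1"
    note clip = threefold_axis_clip[OF g[unfolded a]]
    have "3 dvd m" using clip(2) A by blast
    then show ?thesis
      using clip(1) conj_class_Z_3 by (simp add: listed_class_def)
  qed
qed

text \<open>
  A nontrivial element whose rotation fixes the main axis makes that axis special, and a translation by a
  tetrahedral symmetry reduces it to one of the three standard directions.
\<close>

lemma clip_listed:
  assumes g: "orthogonal_matrix g" "m > 0"
  shows "listed_class m (conj_class (clip g m))"
proof (cases "\<exists>A\<in>clip g m. A \<noteq> mat 1 \<and> rotpart A *v (g *v e3) = g *v e3")
  case False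
  then have "conj_class (clip g m) \<in> {conj_class trivial_group, conj_class (Z 2), conj_class (Z2k_minus 1)}"
    by (intro small_clip_class[OF g]) blast
  then show ?thesis by (simp add: listed_class_def)
next
  case True
  then obtain A where A: "A \<in> O_minus" "A \<noteq> mat 1" "rotpart A *v (g *v e3) = g *v e3" 
    by (auto simp: clip_def)
  have "transpose g *v (g *v e3) = e3"
    using g(1) by (simp add: matrix_vector_mul_assoc orthogonal_matrix_def del: transpose_matrix_vector)
  then have "g *v e3 \<noteq> 0"
    by (metis axis_eq_0_iff matrix_vector_mult_0_right zero_neq_one)
  from special_axis_cases[OF A this] obtain t c b where t: "t \<in> O_minus" "c \<noteq> 0" "t *v (g *v e3) = c *\<^sub>R b"
    and b: "b = v3 0 0 1 \<or> b = v3 1 (-1) 0 \<or> b = v3 1 1 1"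
    unfolding conj_axis_def by blast
  have "orthogonal_matrix (t ** g)"
    using t(1) g(1) subgroup.subset[OF O_minus_subgroup] by (simp add: orthogonal_matrix_mul subset_iff)
  then have "listed_class m (conj_class (clip (t ** g) m))"
    using special_axis_clip_listed[OF _ g(2) _ t(2) b] t(3) by (simp add: matrix_vector_mul_assoc)
  then show ?thesis
    using clip_translate(2)[OF t(1) g(1)] by simp
qed

text \<open>
  The vectors \<open>(1,2,4)\<close>, \<open>(1,2,0)\<close> and \<open>(1,1,3)\<close> serve as main axes for the classes \<open>[1]\<close>, \<open>[\<int>\<^sub>2]\<close> and \<open>[\<int>\<^sub>2\<^sup>-]\<close>,
  with secondary axes \<open>e\<^sub>3\<close> and \<open>e\<^sub>1 - e\<^sub>2\<close> in the last two cases. These choices work for all \<open>m\<close>. The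
  remaining classes need one of the special main axes.
\<close>

lemma listed_class_realized:
  assumes "listed_class m C" "m > 0"
  shows "\<exists>g. orthogonal_matrix g \<and> C = conj_class (clip g m)"
proof -
  let ?H = "m3 (-1) 0 0 0 (-1) 0 0 0 1" and ?R = "m3 0 1 0 1 0 0 0 0 1"
  have orth: "orthogonal_matrix ?H" "orthogonal_matrix ?R"
    by (simp_all add: orthogonal_matrix_def m3_simps)
  have nz: "v3 x y z \<noteq> 0 \<longleftrightarrow> x \<noteq> 0 \<or> y \<noteq> 0 \<or> z \<noteq> 0" for x y z
    by (auto simp: vec_eq_iff forall_3)
  note real = prism_realization[OF assms(2)]
  have triv: ?thesis if "C = conj_class trivial_group"
  proof -
    \<comment> \<open>any vector orthogonal to the main axis will do for \<open>?b\<close>, since only the identity of \<open>O_minus\<close> preserves that axis\<close>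
    let ?a = "v3 1 2 4" and ?b = "v3 2 (-1) 0"
    have "?a \<bullet> ?b = 0" by (simp add: m3_simps)
    then obtain g where g: "orthogonal_matrix g" "g *v e3 = ?a /\<^sub>R norm ?a"
      using frame_exists[of "?a /\<^sub>R norm ?a" "?b /\<^sub>R norm ?b"] by (auto simp: nz)
    have "clip g m = trivial_group"
      using one_in_prism[OF g(1)]
      by (subst clip_eq_axis_stab[OF g(1) assms(2) g(2)])
         (auto simp: nz axis_stab_eq trivial_group_def m3_simps)
    then show ?thesis using g that by (intro exI[of _ g]) simp
  qed
  have Z2: ?thesis if "C = conj_class (Z 2)"
  proof -
    obtain g h c where g: "orthogonal_matrix g" "c \<noteq> 0" "g *v e3 = c *\<^sub>R v3 1 2 0" "?H \<in> prism g m"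
      by (rule real[OF orth(1), of "v3 1 2 0" "v3 0 0 1"]) (auto simp: nz rotpart_def m3_simps)
    have "clip g m = Z 2"
      unfolding clip_eq_axis_stab[OF g(1) assms(2) g(3,2)] axis_stab_eq Z_2_eq
      using g(4) one_in_prism[OF g(1)] by auto
    then show ?thesis using g that by (intro exI[of _ g]) simp
  qed
  have Z2m: ?thesis if "C = conj_class (Z2k_minus 1)"
  proof -
    obtain g h c where g: "orthogonal_matrix g" "c \<noteq> 0" "g *v e3 = c *\<^sub>R v3 1 1 3" "?R \<in> prism g m"
      by (rule real[OF orth(2), of "v3 1 1 3" "v3 1 (-1) 0"]) (auto simp: nz rotpart_def m3_simps)
    have "clip g m = {m3 1 0 0 0 1 0 0 0 1, ?R}"
      unfolding clip_eq_axis_stab[OF g(1) assms(2) g(3,2)] axis_stab_eq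
      using g(4) one_in_prism[OF g(1)] by auto
    then show ?thesis using g that reflection_class by metis
  qed
  have Z3: ?thesis if "3 dvd m" "C = conj_class (Z 3) \<or> C = conj_class (Dz 3)"
  proof -
    obtain g h c where "orthogonal_matrix g" "orthogonal_matrix h" "c \<noteq> 0"
      "g *v e3 = c *\<^sub>R v3 1 1 1" "h *v e3 = c *\<^sub>R v3 1 1 1" "?R \<in> prism g m" "?R \<notin> prism h m"
      by (rule real[OF orth(2), of "v3 1 1 1" "v3 1 (-1) 0"]) (auto simp: nz rotpart_def m3_simps)
    then show ?thesis
      using that threefold_axis_clip(1)[OF _ assms(2)] conj_class_Z_3 by metis
  qed
  have Dz2: ?thesis if "2 dvd m" "C = conj_class (Dz 2)"
  proof -
    obtain g h c where g: "orthogonal_matrix g" "c \<noteq> 0" "g *v e3 = c *\<^sub>R v3 1 (-1) 0" "?H \<in> prism g m"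
      by (rule real[OF orth(1), of "v3 1 (-1) 0" "v3 0 0 1"]) (auto simp: nz rotpart_def m3_simps)
    then show ?thesis
      using that twofold_axis_clip(1)[OF g(1) assms(2) g(3,2)] conj_class_Dz_2 by metis
  qed
  obtain g h c where gh: "orthogonal_matrix g" "orthogonal_matrix h" "c \<noteq> 0"
      "g *v e3 = c *\<^sub>R v3 0 0 1" "h *v e3 = c *\<^sub>R v3 0 0 1" "flip \<in> prism g m" "flip \<notin> prism h m"
    by (rule real[OF orthogonal_flip, of "v3 0 0 1" "v3 1 0 0"]) (auto simp: nz rotpart_def flip_def m3_simps)
  note clips = fourfold_axis_clip[OF gh(1) assms(2) gh(4,3)] fourfold_axis_clip[OF gh(2) assms(2) gh(5,3)]
  have D2: ?thesis if "2 dvd m" "\<not> 4 dvd m" "C = conj_class (D 2)"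
    using clips(2)[OF that(1,2)] gh that by metis
  have D4: ?thesis if "4 dvd m" "C = conj_class (Z2k_minus 2) \<or> C = conj_class (D2k_d 2)"
    using clips(1,4)[OF that(1)] gh that by metis
  from assms(1) show ?thesis
    unfolding listed_class_def using triv Z2 Z2m Z3 Dz2 D2 D4 by blast
qed

theorem lemma4p20:
  fixes m d3 :: nat
  assumes "m \<ge> 2" and "d3 = gcd 3 m"
  shows "conj_class O_minus \<circledcirc> conj_class (with_Z2c (D m)) =
    (if 4 dvd m then
       {conj_class trivial_group, conj_class (Z 2), conj_class (Z2k_minus 1),
        conj_class (Z d3), conj_class (Dz d3),
        conj_class (Z2k_minus 2), conj_class (Dz 2), conj_class (D2k_d 2)}
     else if even m then
       {conj_class trivial_group, conj_class (Z 2), conj_class (Z2k_minus 1),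
        conj_class (Z d3), conj_class (Dz d3),
        conj_class (D 2), conj_class (Dz 2)}
     else
       {conj_class trivial_group, conj_class (Z 2), conj_class (Z2k_minus 1),
        conj_class (Z d3), conj_class (Dz d3)})"
proof -
  have "m > 0" using assms(1) by simp
  have "O_minus \<subseteq> carrier O3" "with_Z2c (D m) \<subseteq> carrier O3"
    using subgroup.subset O_minus_subgroup with_Z2c_subgroup[OF D_subgroup] by blast+
  then have "conj_class O_minus \<circledcirc> conj_class (with_Z2c (D m)) =
      {conj_class (clip g m) |g. orthogonal_matrix g}"
    by (simp add: clips_conj_class clip_def prism_def)
  also have "\<dots> = {C. listed_class m C}"
    using clip_listed listed_class_realized \<open>m > 0\<close> by blast
  finally have eq: "conj_class O_minus \<circledcirc> conj_class (with_Z2c (D m)) = {C. listed_class m C}" .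
  have even: "even m" if "4 dvd m"
    using that by (rule dvd_trans[rotated]) simp
  show ?thesis
  proof (cases "3 dvd m")
    case True
    then have d3: "d3 = 3" using assms(2) by (simp add: gcd_nat.absorb1)
    show ?thesis
      unfolding eq d3 listed_class_def using True even by auto
  next
    case False
    then have "coprime 3 m" by (intro prime_imp_coprime) auto
    then have d3: "d3 = 1" using assms(2) by simp
    show ?thesis
      unfolding eq d3 listed_class_def Z_1 conj_class_Dz_1 using False even by auto
  qed
qed

end
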